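(* Let $F$ be a $C^\infty$ vector field defined near the origin $O\in\mathbb{R}^n$ with $F(O)=0$. Suppose that $F$ is not flat at $O$, i.e. there exists $p\ge1$ such that $j^{p-1}(F)=0$ and $P=j^{p}(F):\mathbb{R}^n\to\mathbb{R}^n$ is a non-zero homogeneous map of degree $p$. For $p=1$ write $P(x)=L\cdot x$, where $L$ is a non-zero $(n\times n)$-matrix. Let $\mathcal{G}$ be a subgroup of $\hat{\mathcal{D}}(\mathbb{R}^n)$ having the following properties. (A1) $\hat{Sh}(\mathbf{F})\subset\mathcal{G}$. (A2) For every $h\in\mathcal{G}$ there exists $\omega_0\in\mathbb{R}$ such that $$j^{p}(h)(x)=j^{p}(\mathbf{F}_{\omega_0})(x)=\begin{cases} e^{L\omega_0}\cdot x, & p=1,\\ x+P(x)\cdot\omega_0, & p\ge2.\end{cases}$$ (A3) Moreover, if $h\in\mathcal{G}$ and $j^{k-1}(h)=j^{k-1}(\mathrm{id})$ for some $k\ge p$ with $k\geq 2$, then there exists a unique homogeneous polynomial $\omega_l$ of degree $l=k-p$ such that $$j^{k}(h)(x)=j^{k}(\mathbf{F}_{\omega_l})(x)=x+P(x)\cdot\omega_l(x).$$ Then $j^{\infty}\bigl(\hat{Sh}(\mathbf{F})\bigr)=j^{\infty}(\mathcal{G})$. In other words, $\hat{Sh}(\mathbf{F})\subset\mathcal{G}\subset\hat{\mathcal{J}}(\mathbf{F})$.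
   Context: $\hat{\mathcal{D}}(\mathbb{R}^n)$ is the group of germs at $O$ of $C^\infty$ diffeomorphisms $h$ of $\mathbb{R}^n$ with $h(O)=O$; $\hat{\mathcal{F}}(\mathbb{R}^n)$ is the algebra of germs at $O$ of $C^\infty$ functions $\mathbb{R}^n\to\mathbb{R}$. $j^k(\cdot)$ denotes the $k$-jet at $O$ (Taylor polynomial of degree $k$; for $k=\infty$ the Taylor series). "Homogeneous polynomial of degree $l$" includes the zero polynomial. $\mathbf{F}(x,t)$ is the local flow of $F$. Since $F(O)=0$, for every $\alpha\in\hat{\mathcal{F}}(\mathbb{R}^n)$ the map $\mathbf{F}_\alpha(x)=\mathbf{F}(x,\alpha(x))$ is a well-defined germ at $O$ and belongs to $\hat{\mathcal{D}}(\mathbb{R}^n)$. $\hat{Sh}(\mathbf{F})=\{\mathbf{F}_\alpha:\alpha\in\hat{\mathcal{F}}(\mathbb{R}^n)\}$. $\hat{\mathcal{J}}(\mathbf{F})=(j^\infty)^{-1}[j^\infty(\hat{Sh}(\mathbf{F}))]$ is the subgroup of $\hat{\mathcal{D}}(\mathbb{R}^n)$ consisting of germs $h$ for which there exists $\alpha_h\in\hat{\mathcal{F}}(\mathbb{R}^n)$ with $j^\infty(h)=j^\infty(\mathbf{F}_{\alpha_h})$. *)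

theory Defs
  imports "HOL-Analysis.Analysis" "HOL-Algebra.Group"
begin

section \<open>Smooth maps\<close>

fun Ck_on :: "nat \<Rightarrow> 'a::euclidean_space set \<Rightarrow> ('a \<Rightarrow> 'b::real_normed_vector) \<Rightarrow> bool" where
  "Ck_on 0 U f \<longleftrightarrow> continuous_on U f"
| "Ck_on (Suc k) U f \<longleftrightarrow>
     (\<forall>x\<in>U. f differentiable (at x)) \<and> (\<forall>v. Ck_on k U (\<lambda>x. frechet_derivative f (at x) v))"

text \<open>Only meant for open \<open>U\<close>, since the derivatives are taken in the whole space.\<close>

definition smooth_on :: "'a::euclidean_space set \<Rightarrow> ('a \<Rightarrow> 'b::real_normed_vector) \<Rightarrow> bool" where
  "smooth_on U f \<longleftrightarrow> (\<forall>k. Ck_on k U f)"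

definition smooth_near0 :: "('a::euclidean_space \<Rightarrow> 'b::real_normed_vector) \<Rightarrow> bool" where
  "smooth_near0 f \<longleftrightarrow> (\<exists>U. open U \<and> 0 \<in> U \<and> smooth_on U f)"

section \<open>Germs at the origin\<close>

text \<open>The germ of a map is its class under equality near the origin.\<close>

definition germ :: "('a::{topological_space,zero} \<Rightarrow> 'b) \<Rightarrow> ('a \<Rightarrow> 'b) set" where
  "germ f = {g. \<forall>\<^sub>F x in nhds 0. g x = f x}"

definition local_diffeo :: "('a::euclidean_space \<Rightarrow> 'a) \<Rightarrow> bool" where
  "local_diffeo h \<longleftrightarrow> h 0 = 0 \<and>
     (\<exists>U V g. open U \<and> 0 \<in> U \<and> open V \<and> homeomorphism U V h g \<and> smooth_on U h \<and> smooth_on V g)"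

text \<open>On germs of maps that are continuous at the origin and fix it, this is a single class;
  see \<open>germ_comp_germ\<close> below.\<close>

definition germ_comp :: "('a::{topological_space,zero} \<Rightarrow> 'a) set \<Rightarrow> ('a \<Rightarrow> 'a) set \<Rightarrow> ('a \<Rightarrow> 'a) set" where
  "germ_comp A B = (\<Union>f\<in>A. \<Union>g\<in>B. germ (f \<circ> g))"

definition diffeo_germs :: "('a::euclidean_space \<Rightarrow> 'a) set monoid" where
  "diffeo_germs = \<lparr>carrier = {germ h |h. local_diffeo h}, mult = germ_comp, one = germ id\<rparr>"

section \<open>Jets at the origin\<close>

text \<open>\<open>taylor_term i f\<close> is the homogeneous part of degree \<open>i\<close> of the Taylor series, i.e.
  \<open>v \<mapsto> D\<^sup>if(0)(v,\<dots>,v) / i!\<close>, with the derivative written as an iterated directional derivative.\<close>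

definition taylor_term :: "nat \<Rightarrow> ('a::euclidean_space \<Rightarrow> 'b::real_normed_vector) \<Rightarrow> 'a \<Rightarrow> 'b" where
  "taylor_term i f v = ((\<lambda>g x. frechet_derivative g (at x) v) ^^ i) f 0 /\<^sub>R fact i"

definition jet :: "nat \<Rightarrow> ('a::euclidean_space \<Rightarrow> 'b::real_normed_vector) \<Rightarrow> 'a \<Rightarrow> 'b" where
  "jet k f = (\<lambda>x. \<Sum>i\<le>k. taylor_term i f x)"

text \<open>A formal power series is represented by the sequence of its homogeneous parts.\<close>

definition jet_inf :: "('a::euclidean_space \<Rightarrow> 'b::real_normed_vector) \<Rightarrow> nat \<Rightarrow> 'a \<Rightarrow> 'b" where
  "jet_inf f = (\<lambda>i. taylor_term i f)"

definition jets_inf :: "('a::euclidean_space \<Rightarrow> 'b::real_normed_vector) set set \<Rightarrow> (nat \<Rightarrow> 'a \<Rightarrow> 'b) set" where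
  "jets_inf A = {jet_inf h |h. germ h \<in> A}"

section \<open>Homogeneous polynomials\<close>

definition homogeneous_poly :: "nat \<Rightarrow> (real^'n \<Rightarrow> real) \<Rightarrow> bool" where
  "homogeneous_poly l \<omega> \<longleftrightarrow>
     (\<exists>c :: ('n \<Rightarrow> nat) \<Rightarrow> real.
        \<forall>x. \<omega> x = (\<Sum>\<alpha> | (\<Sum>i\<in>UNIV. \<alpha> i) = l. c \<alpha> * (\<Prod>i\<in>UNIV. (x $ i) ^ \<alpha> i)))"

definition homogeneous_map :: "nat \<Rightarrow> (real^'n \<Rightarrow> real^'m) \<Rightarrow> bool" where
  "homogeneous_map l P \<longleftrightarrow> (\<forall>j. homogeneous_poly l (\<lambda>x. P x $ j))"

section \<open>Matrix exponential\<close>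

text \<open>The class multiplication on \<open>real^'n^'n\<close> is componentwise, so the library exponential
  is not the matrix exponential.\<close>

definition mat_exp :: "real^'n^'n \<Rightarrow> real^'n^'n" where
  "mat_exp A = (\<Sum>k. ((**) A ^^ k) (mat 1) /\<^sub>R fact k)"

section \<open>The local flow and shifts along it\<close>

definition integral_curve ::
    "'a::real_normed_vector set \<Rightarrow> ('a \<Rightarrow> 'a) \<Rightarrow> 'a \<Rightarrow> real \<Rightarrow> (real \<Rightarrow> 'a) \<Rightarrow> bool" where
  "integral_curve W F x t \<gamma> \<longleftrightarrow> \<gamma> 0 = x \<and>
     (\<forall>s\<in>closed_segment 0 t. \<gamma> s \<in> W \<and>
        (\<gamma> has_vector_derivative F (\<gamma> s)) (at s within closed_segment 0 t))"

text \<open>The point reached at time \<open>t\<close> (of either sign) from \<open>x\<close> along \<open>F\<close> inside \<open>W\<close>. It is unspecified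
  where the solution does not exist up to time \<open>t\<close>; if \<open>F 0 = 0\<close> this does not affect the germs
  of shifts below, as solutions exist for all \<open>(x, t)\<close> in a neighbourhood of \<open>{0} \<times> \<real>\<close>.\<close>

definition local_flow :: "'a::real_normed_vector set \<Rightarrow> ('a \<Rightarrow> 'a) \<Rightarrow> 'a \<Rightarrow> real \<Rightarrow> 'a" where
  "local_flow W F x t = (THE y. \<exists>\<gamma>. integral_curve W F x t \<gamma> \<and> \<gamma> t = y)"

definition shift :: "'a::real_normed_vector set \<Rightarrow> ('a \<Rightarrow> 'a) \<Rightarrow> ('a \<Rightarrow> real) \<Rightarrow> 'a \<Rightarrow> 'a" where
  "shift W F \<alpha> = (\<lambda>x. local_flow W F x (\<alpha> x))"

definition Sh :: "'a::euclidean_space set \<Rightarrow> ('a \<Rightarrow> 'a) \<Rightarrow> ('a \<Rightarrow> 'a) set set" where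
  "Sh W F = {germ (shift W F \<alpha>) |\<alpha>. smooth_near0 \<alpha>}"

definition JSh :: "'a::euclidean_space set \<Rightarrow> ('a \<Rightarrow> 'a) \<Rightarrow> ('a \<Rightarrow> 'a) set set" where
  "JSh W F = {germ h |h. local_diffeo h \<and> jet_inf h \<in> jets_inf (Sh W F)}"

section \<open>Well-definedness on germs\<close>

lemma germ_self: "f \<in> germ f"
  by (simp add: germ_def)

lemma germ_eq_iff: "germ f = germ g \<longleftrightarrow> (\<forall>\<^sub>F x in nhds 0. f x = g x)"
proof
  assume "germ f = germ g"
  then show "\<forall>\<^sub>F x in nhds 0. f x = g x"
    using germ_self[of f] by (metis (mono_tags) germ_def mem_Collect_eq)
next
  assume *: "\<forall>\<^sub>F x in nhds 0. f x = g x"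
  have "h \<in> germ f \<longleftrightarrow> h \<in> germ g" for h
    unfolding germ_def mem_Collect_eq
    by (intro eventually_subst eventually_mono[OF *]) simp
  then show "germ f = germ g" by blast
qed

lemma germ_comp_germ:
  fixes f g :: "'a::{t2_space,zero} \<Rightarrow> 'a"
  assumes "isCont g 0" "g 0 = 0"
  shows "germ_comp (germ f) (germ g) = germ (f \<circ> g)"
proof -
  have "germ (f' \<circ> g') = germ (f \<circ> g)" if f': "f' \<in> germ f" and g': "g' \<in> germ g" for f' g'
  proof -
    have "filterlim g (nhds 0) (nhds 0)"
      using assms by (metis isContD tendsto_at_iff_tendsto_nhds)
    with f' have "\<forall>\<^sub>F x in nhds 0. f' (g x) = f (g x)"
      unfolding germ_def filterlim_iff by blast
    moreover have "\<forall>\<^sub>F x in nhds 0. g' x = g x"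
      using g' by (simp add: germ_def)
    ultimately have "\<forall>\<^sub>F x in nhds 0. (f' \<circ> g') x = (f \<circ> g) x"
      by eventually_elim simp
    then show ?thesis by (simp add: germ_eq_iff)
  qed
  then have "germ_comp (germ f) (germ g) = (\<Union>f'\<in>germ f. \<Union>g'\<in>germ g. germ (f \<circ> g))"
    unfolding germ_comp_def by (intro SUP_cong refl) simp
  also have "\<dots> = germ (f \<circ> g)"
    using germ_self[of f] germ_self[of g] by auto
  finally show ?thesis .
qed

lemma frechet_derivative_eventually_cong:
  assumes "\<forall>\<^sub>F y in nhds x. f y = g y"
  shows "frechet_derivative f (at x) = frechet_derivative g (at x)"
proof -
  have "f x = g x" and "\<forall>\<^sub>F y in at x. f y = g y"
    using assms by (simp_all add: eventually_nhds_conv_at)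
  then have "(f has_derivative D) (at x) \<longleftrightarrow> (g has_derivative D) (at x)" for D
    by (metis (mono_tags, lifting) UNIV_I eventually_mono has_derivative_transform_eventually)
  then show ?thesis by (simp add: frechet_derivative_def)
qed

lemma taylor_term_germ:
  fixes f g :: "'a::euclidean_space \<Rightarrow> 'b::real_normed_vector"
  assumes "germ f = germ g"
  shows "taylor_term i f = taylor_term i g"
proof
  fix v
  let ?D = "\<lambda>(h :: 'a \<Rightarrow> 'b) x. frechet_derivative h (at x) v"
  have "\<forall>\<^sub>F x in nhds 0. (?D ^^ i) f x = (?D ^^ i) g x"
  proof (induction i)
    case 0
    then show ?case using assms by (simp add: germ_eq_iff)
  next
    case (Suc i)
    then have "\<forall>\<^sub>F x in nhds 0. \<forall>\<^sub>F y in nhds x. (?D ^^ i) f y = (?D ^^ i) g y"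
      by (simp add: eventually_eventually)
    then show ?case
      by eventually_elim (simp add: frechet_derivative_eventually_cong)
  qed
  then show "taylor_term i f v = taylor_term i g v"
    by (auto simp: taylor_term_def dest: eventually_nhds_x_imp_x)
qed

lemma jet_germ: "germ f = germ g \<Longrightarrow> jet k f = jet k g"
  by (simp add: jet_def taylor_term_germ[of f g])

lemma jet_inf_germ: "germ f = germ g \<Longrightarrow> jet_inf f = jet_inf g"
  by (simp add: jet_inf_def taylor_term_germ[of f g])

end

theory Submission
  imports Defs
begin

text \<open>
  The goal is to find, for every \<open>h\<close> with germ in \<open>G\<close>, a smooth \<open>\<alpha>\<close> such that \<open>h\<close> and the shift
  \<open>F\<^sub>\<alpha> = shift W F \<alpha>\<close> have the same Taylor series. Two maps that are smooth near the origin have the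
  same \<open>k\<close>-jet iff their difference is \<open>O(\<bar>x\<bar>\<^sup>k\<^sup>+\<^sup>1)\<close> (\<open>jet_eq_imp_vanishes_to\<close> and
  \<open>vanishes_to_imp_taylor_term_eq\<close>), so all jets are handled through the order of vanishing of
  differences (\<open>vanishes_to\<close>).

  The function \<open>\<alpha>\<close> is built by successive approximation. Suppose \<open>h - F\<^sub>\<alpha>\<close> vanishes to order
  \<open>p + j + 1\<close>. Then \<open>h' = h \<circ> F\<^sub>\<alpha>\<^sup>-\<^sup>1\<close> has its germ in \<open>G\<close> and agrees with the identity up to degree
  \<open>p + j\<close>, so (A3) provides a homogeneous polynomial \<open>\<omega>\<close> of degree \<open>j + 1\<close> such that \<open>h'\<close> and \<open>F\<^sub>\<omega>\<close> agree
  up to degree \<open>p + j + 1\<close>. Hence \<open>h\<close> agrees to that degree with \<open>F\<^sub>\<omega> \<circ> F\<^sub>\<alpha>\<close>, which is the shift by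
  \<open>\<alpha> + \<omega> \<circ> F\<^sub>\<alpha>\<close> because times add up along the flow (\<open>shift_shift\<close>). As \<open>F\<close> is \<open>O(\<bar>x\<bar>\<^sup>p)\<close>, a change of
  the time by \<open>O(\<bar>x\<bar>\<^sup>l)\<close> moves the shift by only \<open>O(\<bar>x\<bar>\<^sup>p\<^sup>+\<^sup>l)\<close> (\<open>shift_diff_vanishes_to\<close>). So
  \<open>\<omega> \<circ> F\<^sub>\<alpha>\<close> may be replaced by any \<open>\<phi>\<close> with the same leading part \<open>\<omega> \<circ> A\<close>, where \<open>A\<close> is the derivative of
  \<open>F\<^sub>\<alpha>\<close> at the origin (\<open>approximation_step\<close>). (A2) starts the process.

  That freedom is what makes the infinite sum of the corrections smooth: \<open>\<phi>\<close> is taken to be \<open>\<omega> \<circ> A\<close>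
  times a Gaussian \<open>exp (- \<bar>x\<bar>\<^sup>2 / s\<^sup>2)\<close>, which agrees with \<open>\<omega> \<circ> A\<close> up to a relative error \<open>O(\<bar>x\<bar>\<^sup>2)\<close>
  and has derivatives of order at most \<open>j\<close> as small as desired if \<open>s\<close> is small (\<open>borel_term\<close>). The
  error of higher order is absorbed by the later corrections. The sum is smooth and each partial sum
  approximates it to the right order (\<open>borel_sum\<close>).

  That shifts are smooth near the origin follows from (A1), since the elements of \<open>G\<close> are germs of
  diffeomorphisms. The flow itself enters through existence, uniqueness, the group law and exponential
  growth of trajectories (\<open>flow_near_zero_exists\<close>).
\<close>

section \<open>Directional derivatives of smooth maps\<close>

abbreviation dderiv :: "'a \<Rightarrow> ('a \<Rightarrow> 'b) \<Rightarrow> 'a::real_normed_vector \<Rightarrow> 'b::real_normed_vector"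
  where "dderiv v g \<equiv> (\<lambda>x. frechet_derivative g (at x) v)"

lemma smooth_on_differentiable:
  assumes "smooth_on U f" "x \<in> U"
  shows "f differentiable (at x)"
proof -
  have "Ck_on (Suc 0) U f" using assms(1) unfolding smooth_on_def by (rule spec)
  then show ?thesis using assms(2) by simp
qed

lemma smooth_on_dderiv:
  assumes "smooth_on U f"
  shows "smooth_on U (dderiv v f)"
  unfolding smooth_on_def
proof
  fix k
  have "Ck_on (Suc k) U f" using assms unfolding smooth_on_def by (rule spec)
  then show "Ck_on k U (dderiv v f)" by simp
qed

lemma smooth_on_dderiv_iter: "smooth_on U f \<Longrightarrow> smooth_on U ((dderiv v ^^ m) f)"
proof (induction m)
  case (Suc m)
  then show ?case using smooth_on_dderiv[of U "(dderiv v ^^ m) f" v] by simp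
qed simp

lemma smooth_on_continuous: "smooth_on U f \<Longrightarrow> continuous_on U f"
  by (intro continuous_at_imp_continuous_on ballI differentiable_imp_continuous_within
      smooth_on_differentiable)

lemma Ck_on_subset: "Ck_on k U f \<Longrightarrow> V \<subseteq> U \<Longrightarrow> Ck_on k V f"
proof (induction k arbitrary: f)
  case 0
  then show ?case unfolding Ck_on.simps by (rule continuous_on_subset)
next
  case (Suc k)
  show ?case
    using Suc.prems unfolding Ck_on.simps by (blast intro: Suc.IH)
qed

lemma dderiv_cong_open:
  assumes "open U" "x \<in> U" "\<And>y. y \<in> U \<Longrightarrow> f y = g y"
  shows "frechet_derivative f (at x) = frechet_derivative g (at x)"
  using assms by (intro frechet_derivative_eventually_cong) (auto simp: eventually_nhds)

lemma Ck_on_cong: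
  assumes "open U" "\<And>x. x \<in> U \<Longrightarrow> f x = g x" "Ck_on k U f"
  shows "Ck_on k U g"
  using assms(2,3)
proof (induction k arbitrary: f g)
  case 0
  then show ?case unfolding Ck_on.simps by (metis continuous_on_cong)
next
  case (Suc k)
  have eq: "frechet_derivative f (at x) = frechet_derivative g (at x)" if "x \<in> U" for x
    using \<open>open U\<close> that Suc.prems(1) by (rule dderiv_cong_open)
  have "g differentiable (at x)" if "x \<in> U" for x
  proof -
    have "(f has_derivative frechet_derivative f (at x)) (at x)"
      using Suc.prems(2) that by (simp add: frechet_derivative_works)
    then have "(g has_derivative frechet_derivative f (at x)) (at x)"
      by (rule has_derivative_transform_within_open[OF _ \<open>open U\<close> that Suc.prems(1)])
    then show ?thesis unfolding differentiable_def by blast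
  qed
  moreover have "Ck_on k U (dderiv v g)" for v
  proof (rule Suc.IH[of "dderiv v f"])
    show "Ck_on k U (dderiv v f)"
      using Suc.prems(2) unfolding Ck_on.simps by blast
  qed (simp add: eq)
  ultimately show ?case unfolding Ck_on.simps by blast
qed

text \<open>Smoothness near the origin is a property of the germ, so it can be read off any representative.\<close>

lemma smooth_near0_germ:
  fixes f g :: "'a::euclidean_space \<Rightarrow> 'b::real_normed_vector"
  assumes "smooth_near0 f" "germ f = germ g"
  shows "smooth_near0 g"
proof -
  obtain U where U: "open U" "0 \<in> U" "smooth_on U f"
    using assms(1) by (auto simp: smooth_near0_def)
  obtain V where V: "open V" "0 \<in> V" "\<And>x. x \<in> V \<Longrightarrow> f x = g x"
    using assms(2) by (auto simp: germ_eq_iff eventually_nhds)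
  have "smooth_on (U \<inter> V) g"
    unfolding smooth_on_def
  proof
    fix k
    have "Ck_on k (U \<inter> V) f"
      using U(3) unfolding smooth_on_def by (blast intro: Ck_on_subset)
    then show "Ck_on k (U \<inter> V) g"
      by (rule Ck_on_cong[of "U \<inter> V" f, rotated 2]) (use U(1) V(1,3) in blast)+
  qed
  moreover have "open (U \<inter> V)" "0 \<in> U \<inter> V" using U V by auto
  ultimately show ?thesis unfolding smooth_near0_def by blast
qed

lemma dderiv_basis:
  fixes f :: "'a::euclidean_space \<Rightarrow> 'b::real_normed_vector"
  assumes "f differentiable (at x)"
  shows "frechet_derivative f (at x) v = (\<Sum>b\<in>Basis. (v \<bullet> b) *\<^sub>R frechet_derivative f (at x) b)"
proof -
  have lin: "linear (frechet_derivative f (at x))"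
    using assms by (rule linear_frechet_derivative)
  have "frechet_derivative f (at x) v = frechet_derivative f (at x) (\<Sum>b\<in>Basis. (v \<bullet> b) *\<^sub>R b)"
    by (simp add: euclidean_representation)
  then show ?thesis by (simp only: linear_sum[OF lin] linear_scale[OF lin])
qed

lemma dderiv_iter_sum:
  fixes f :: "'a::euclidean_space \<Rightarrow> 'b::real_normed_vector"
  assumes "open U" "\<And>b. b \<in> B \<Longrightarrow> smooth_on U (g b)"
    and "\<And>x. x \<in> U \<Longrightarrow> f x = (\<Sum>b\<in>B. c b *\<^sub>R g b x)" and "x \<in> U"
  shows "(dderiv v ^^ m) f x = (\<Sum>b\<in>B. c b *\<^sub>R (dderiv v ^^ m) (g b) x)"
  using \<open>x \<in> U\<close>
proof (induction m arbitrary: x)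
  case 0
  then show ?case using assms(3) by simp
next
  case (Suc m)
  have "frechet_derivative ((dderiv v ^^ m) f) (at x)
      = frechet_derivative (\<lambda>y. \<Sum>b\<in>B. c b *\<^sub>R (dderiv v ^^ m) (g b) y) (at x)"
    using \<open>open U\<close> Suc by (intro dderiv_cong_open)
  also have "\<dots> = (\<lambda>h. \<Sum>b\<in>B. c b *\<^sub>R frechet_derivative ((dderiv v ^^ m) (g b)) (at x) h)"
  proof (intro frechet_derivative_at[symmetric] has_derivative_sum has_derivative_scaleR_right)
    fix b assume "b \<in> B"
    then show "((dderiv v ^^ m) (g b) has_derivative frechet_derivative ((dderiv v ^^ m) (g b)) (at x)) (at x)"
      using smooth_on_differentiable[OF smooth_on_dderiv_iter[OF assms(2)] Suc.prems]
      by (simp add: frechet_derivative_works)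
  qed
  finally show ?case by simp
qed

text \<open>The bound has to be uniform in the direction \<open>v\<close>. Writing \<open>v\<close> in the standard basis turns
  \<open>D\<^sub>v\<^sup>m\<^sup>+\<^sup>1 f\<close> into a combination of the functions \<open>D\<^sub>v\<^sup>m (D\<^sub>b f)\<close> with coefficients \<open>v \<bullet> b\<close>, so that
  induction on \<open>m\<close>, for all smooth \<open>f\<close> at once, reduces it to the boundedness of continuous functions on
  compact sets.\<close>

lemma dderiv_iter_bound:
  fixes f :: "'a::euclidean_space \<Rightarrow> 'b::real_normed_vector"
  assumes "open U" "compact K" "K \<subseteq> U" "smooth_on U f"
  shows "\<exists>C\<ge>0. \<forall>x\<in>K. \<forall>v. norm ((dderiv v ^^ m) f x) \<le> C * norm v ^ m"
  using assms(4)
proof (induction m arbitrary: f)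
  case 0
  have "bounded (f ` K)"
    using compact_continuous_image[OF continuous_on_subset[OF smooth_on_continuous[OF 0] \<open>K \<subseteq> U\<close>]]
    by (simp add: assms(2) compact_imp_bounded)
  then obtain C where C: "\<And>x. x \<in> K \<Longrightarrow> norm (f x) \<le> C" by (auto simp: bounded_iff)
  then show ?case by (intro exI[of _ "max C 0"]) (auto intro: max.coboundedI1)
next
  case (Suc m)
  have "\<exists>C\<ge>0. \<forall>x\<in>K. \<forall>v. norm ((dderiv v ^^ m) (dderiv b f) x) \<le> C * norm v ^ m" for b
    by (rule Suc.IH) (intro smooth_on_dderiv Suc.prems)
  then obtain C where C0: "\<And>b. C b \<ge> 0"
    and C: "\<And>b x v. x \<in> K \<Longrightarrow> norm ((dderiv v ^^ m) (dderiv b f) x) \<le> C b * norm v ^ m"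
    by metis
  show ?case
  proof (intro exI[of _ "\<Sum>b\<in>Basis. C b"] conjI ballI allI)
    show "(\<Sum>b\<in>(Basis::'a set). C b) \<ge> 0" by (simp add: C0 sum_nonneg)
    fix x v assume x: "x \<in> K"
    have "(dderiv v ^^ Suc m) f x = (dderiv v ^^ m) (dderiv v f) x"
      by (simp only: funpow_Suc_right o_apply)
    also have "\<dots> = (\<Sum>b\<in>Basis. (v \<bullet> b) *\<^sub>R (dderiv v ^^ m) (dderiv b f) x)"
      using x \<open>K \<subseteq> U\<close> Suc.prems
      by (intro dderiv_iter_sum[OF \<open>open U\<close>] smooth_on_dderiv dderiv_basis smooth_on_differentiable) auto
    also have "norm \<dots> \<le> (\<Sum>b\<in>Basis. norm v * (C b * norm v ^ m))"
      using C[OF x] by (intro sum_norm_le) (auto intro!: mult_mono simp: Basis_le_norm)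
    also have "\<dots> = (\<Sum>b\<in>Basis. C b) * norm v ^ Suc m"
      by (simp add: sum_distrib_right sum_distrib_left mult_ac)
    finally show "norm ((dderiv v ^^ Suc m) f x) \<le> (\<Sum>b\<in>Basis. C b) * norm v ^ Suc m" .
  qed
qed

lemma smooth_on_lipschitz:
  fixes f :: "'a::euclidean_space \<Rightarrow> 'b::real_normed_vector"
  assumes "open U" "compact K" "convex K" "K \<subseteq> U" "smooth_on U f"
  obtains M where "M \<ge> 0" "\<And>x y. x \<in> K \<Longrightarrow> y \<in> K \<Longrightarrow> norm (f x - f y) \<le> M * norm (x - y)"
proof -
  obtain M where M: "M \<ge> 0" "\<And>x v. x \<in> K \<Longrightarrow> norm (frechet_derivative f (at x) v) \<le> M * norm v"
    using dderiv_iter_bound[OF assms(1,2,4,5), of 1] by auto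
  have "norm (f x - f y) \<le> M * norm (x - y)" if "x \<in> K" "y \<in> K" for x y
  proof (rule differentiable_bound[OF \<open>convex K\<close> _ _ that])
    fix z assume z: "z \<in> K"
    then have "f differentiable (at z)"
      using assms(4) by (intro smooth_on_differentiable[OF assms(5)]) auto
    then show "(f has_derivative frechet_derivative f (at z)) (at z within K)"
      by (simp add: frechet_derivative_works has_derivative_at_withinI)
    show "onorm (frechet_derivative f (at z)) \<le> M"
      using M z by (intro onorm_bound) (auto simp: mult.commute)
  qed
  with M(1) show ?thesis by (rule that)
qed

lemma smooth_near0_isCont:
  assumes "smooth_near0 f"
  shows "isCont f 0"
proof -
  obtain U where "open U" "0 \<in> U" "smooth_on U f"
    using assms unfolding smooth_near0_def by blast
  then show ?thesis
    by (intro differentiable_imp_continuous_within) (rule smooth_on_differentiable)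
qed

lemma smooth_on_UNIV_near0: "smooth_on UNIV f \<Longrightarrow> smooth_near0 f"
  unfolding smooth_near0_def by (intro exI[of _ UNIV]) simp

section \<open>Order of vanishing at the origin\<close>

definition vanishes_to :: "nat \<Rightarrow> ('a::real_normed_vector \<Rightarrow> 'b::real_normed_vector) \<Rightarrow> bool" where
  "vanishes_to k f \<longleftrightarrow> (\<exists>C. \<forall>\<^sub>F x in nhds 0. norm (f x) \<le> C * norm x ^ k)"

lemma vanishes_toI:
  assumes "r > 0" "\<And>x. norm x \<le> r \<Longrightarrow> norm (f x) \<le> C * norm x ^ k"
  shows "vanishes_to k f"
  unfolding vanishes_to_def eventually_nhds_metric using assms
  by (intro exI[of _ C] exI[of _ r]) auto

lemma vanishes_toE:
  assumes "vanishes_to k f"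
  obtains r C where "r > 0" "C \<ge> 0" "\<And>x. norm x \<le> r \<Longrightarrow> norm (f x) \<le> C * norm x ^ k"
proof -
  obtain C d where "d > 0" and C: "\<And>x. norm x < d \<Longrightarrow> norm (f x) \<le> C * norm x ^ k"
    using assms by (auto simp: vanishes_to_def eventually_nhds_metric)
  have "norm (f x) \<le> \<bar>C\<bar> * norm x ^ k" if "norm x \<le> d / 2" for x
    by (rule order_trans[OF C mult_right_mono]) (use that \<open>d > 0\<close> in auto)
  then show ?thesis using \<open>d > 0\<close> by (intro that[of "d/2" "\<bar>C\<bar>"]) auto
qed

lemma vanishes_to_add:
  assumes "vanishes_to k f" "vanishes_to k g"
  shows "vanishes_to k (\<lambda>x. f x + g x)"
proof -
  obtain C D where "\<forall>\<^sub>F x in nhds 0. norm (f x) \<le> C * norm x ^ k"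
    "\<forall>\<^sub>F x in nhds 0. norm (g x) \<le> D * norm x ^ k"
    using assms by (auto simp: vanishes_to_def)
  then have "\<forall>\<^sub>F x in nhds 0. norm (f x + g x) \<le> (C + D) * norm x ^ k"
    by eventually_elim (simp add: distrib_right norm_triangle_mono)
  then show ?thesis unfolding vanishes_to_def by blast
qed

lemma vanishes_to_minus: "vanishes_to k f \<Longrightarrow> vanishes_to k (\<lambda>x. - f x)"
  by (simp add: vanishes_to_def)

lemma vanishes_to_trans:
  assumes "vanishes_to k (\<lambda>x. f x - g x)" "vanishes_to k (\<lambda>x. g x - h x)"
  shows "vanishes_to k (\<lambda>x. f x - h x)"
  using vanishes_to_add[OF assms] by simp

lemma vanishes_to_sym: "vanishes_to k (\<lambda>x. f x - g x) \<Longrightarrow> vanishes_to k (\<lambda>x. g x - f x)"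
  using vanishes_to_minus[of k "\<lambda>x. f x - g x"] by simp

lemma vanishes_to_transfer:
  assumes "\<forall>\<^sub>F x in nhds 0. f x = g x" "vanishes_to k f"
  shows "vanishes_to k g"
proof -
  obtain C where "\<forall>\<^sub>F x in nhds 0. norm (f x) \<le> C * norm x ^ k"
    using assms(2) by (auto simp: vanishes_to_def)
  with assms(1) have "\<forall>\<^sub>F x in nhds 0. norm (g x) \<le> C * norm x ^ k"
    by eventually_elim simp
  then show ?thesis by (auto simp: vanishes_to_def)
qed

lemma vanishes_to_imp_filterlim:
  assumes "vanishes_to 1 f"
  shows "filterlim f (nhds 0) (nhds 0)"
proof -
  obtain C where C: "\<forall>\<^sub>F x in nhds 0. norm (f x) \<le> C * norm x ^ 1"
    using assms unfolding vanishes_to_def by blast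
  have "((\<lambda>x::'a. x) \<longlongrightarrow> 0) (nhds 0)" by (rule filterlim_ident)
  from tendsto_mult[OF tendsto_const tendsto_norm[OF this]]
  have "((\<lambda>x::'a. C * norm x ^ 1) \<longlongrightarrow> 0) (nhds 0)" by simp
  then show ?thesis by (rule Lim_null_comparison[OF C])
qed

lemma vanishes_to_mono:
  assumes "vanishes_to m f" "k \<le> m"
  shows "vanishes_to k f"
proof -
  obtain r C where r: "r > 0" "C \<ge> 0" "\<And>x. norm x \<le> r \<Longrightarrow> norm (f x) \<le> C * norm x ^ m"
    using vanishes_toE[OF assms(1)] by blast
  show ?thesis
  proof (rule vanishes_toI[of "min r 1"])
    fix x :: 'a assume x: "norm x \<le> min r 1"
    then have "norm (f x) \<le> C * norm x ^ m" by (intro r) auto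
    also have "\<dots> \<le> C * norm x ^ k"
      using x r(2) assms(2) by (intro mult_left_mono power_decreasing) auto
    finally show "norm (f x) \<le> C * norm x ^ k" .
  qed (use r in auto)
qed

lemma vanishes_to_compose:
  assumes u: "vanishes_to k u" and f: "vanishes_to 1 f"
  shows "vanishes_to k (\<lambda>x. u (f x))"
proof -
  obtain r C where r: "r > 0" "C \<ge> 0" "\<And>x. norm x \<le> r \<Longrightarrow> norm (u x) \<le> C * norm x ^ k"
    using vanishes_toE[OF u] by blast
  obtain D where D: "\<forall>\<^sub>F x in nhds 0. norm (f x) \<le> D * norm x ^ 1"
    using f unfolding vanishes_to_def by blast
  have ev: "\<forall>\<^sub>F y in nhds 0. norm (u y) \<le> C * norm y ^ k"
    using r unfolding eventually_nhds_metric by auto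
  have "\<forall>\<^sub>F x in nhds 0. norm (u (f x)) \<le> C * norm (f x) ^ k"
    using ev vanishes_to_imp_filterlim[OF f] by (rule eventually_compose_filterlim)
  with D have "\<forall>\<^sub>F x in nhds 0. norm (u (f x)) \<le> (C * D ^ k) * norm x ^ k"
  proof eventually_elim
    case (elim x)
    note elim(2)
    also have "C * norm (f x) ^ k \<le> C * (D * norm x) ^ k"
      using elim(1) r(2) by (intro mult_left_mono power_mono) auto
    finally show ?case by (simp add: power_mult_distrib mult.assoc)
  qed
  then show ?thesis unfolding vanishes_to_def by blast
qed

lemma vanishes_to_0_isCont:
  assumes "isCont f 0"
  shows "vanishes_to 0 f"
proof -
  have "(f \<longlongrightarrow> f 0) (nhds 0)"
    using assms by (simp add: isCont_def tendsto_at_iff_tendsto_nhds)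
  from tendstoD[OF this zero_less_one]
  have "\<forall>\<^sub>F x in nhds 0. norm (f x) \<le> (norm (f 0) + 1) * norm x ^ 0"
  proof eventually_elim
    case (elim x)
    then show ?case using norm_triangle_sub[of "f x" "f 0"] by (simp add: dist_norm)
  qed
  then show ?thesis unfolding vanishes_to_def by blast
qed

section \<open>Jets and the order of vanishing\<close>

text \<open>One-dimensional Taylor expansion of \<open>\<tau> \<mapsto> f (\<tau> v)\<close> on \<open>[0, t]\<close>. Keeping \<open>t\<close> and \<open>v\<close> separate
  serves two purposes: \<open>t = 1\<close> bounds the remainder uniformly in \<open>v\<close>, while for fixed \<open>v\<close> and \<open>t \<rightarrow> 0\<close>
  the coefficients of the powers of \<open>t\<close> can be compared.\<close>

lemma taylor_bound:
  fixes f :: "'a::euclidean_space \<Rightarrow> 'b::banach"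
  assumes "smooth_near0 f"
  shows "\<exists>r>0. \<exists>C\<ge>0. \<forall>t\<ge>0. \<forall>v. norm (t *\<^sub>R v) \<le> r \<longrightarrow>
      norm (f (t *\<^sub>R v) - (\<Sum>i\<le>k. t ^ i *\<^sub>R taylor_term i f v)) \<le> C * norm (t *\<^sub>R v) ^ Suc k"
proof -
  obtain U where U: "open U" "0 \<in> U" "smooth_on U f"
    using assms by (auto simp: smooth_near0_def)
  then obtain r where r: "r > 0" "cball 0 r \<subseteq> U"
    by (meson open_contains_cball)
  obtain C where C: "C \<ge> 0"
    and Cb: "\<And>x v. x \<in> cball 0 r \<Longrightarrow> norm ((dderiv v ^^ Suc k) f x) \<le> C * norm v ^ Suc k"
    using dderiv_iter_bound[OF U(1) compact_cball r(2) U(3), of "Suc k"] by blast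
  have "norm (f (t *\<^sub>R v) - (\<Sum>i\<le>k. t ^ i *\<^sub>R taylor_term i f v)) \<le> C * norm (t *\<^sub>R v) ^ Suc k"
    if t: "0 \<le> t" "norm (t *\<^sub>R v) \<le> r" for t v
  proof -
    define \<phi> where "\<phi> i \<tau> = (dderiv v ^^ i) f (\<tau> *\<^sub>R v)" for i and \<tau> :: real
    have ball: "\<tau> *\<^sub>R v \<in> cball 0 r" if "0 \<le> \<tau>" "\<tau> \<le> t" for \<tau>
      using that t mult_right_mono[of \<tau> t "norm v"] by simp
    have der: "(\<phi> i has_vector_derivative \<phi> (Suc i) \<tau>) (at \<tau> within {0..t})"
      if "0 \<le> \<tau>" "\<tau> \<le> t" for i \<tau>
    proof -
      have "(dderiv v ^^ i) f differentiable (at (\<tau> *\<^sub>R v))"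
        using ball[OF that] r U(3) by (intro smooth_on_differentiable[OF smooth_on_dderiv_iter]) auto
      then have 1: "((dderiv v ^^ i) f has_derivative frechet_derivative ((dderiv v ^^ i) f) (at (\<tau> *\<^sub>R v)))
          (at (\<tau> *\<^sub>R v))"
        by (simp add: frechet_derivative_works)
      have 2: "((\<lambda>\<tau>. \<tau> *\<^sub>R v) has_vector_derivative v) (at \<tau> within {0..t})"
        by (auto intro!: derivative_eq_intros)
      show ?thesis
        using vector_derivative_diff_chain_within[OF 2 has_derivative_at_withinI[OF 1]]
        by (simp add: \<phi>_def[abs_def] o_def)
    qed
    define R where "R \<tau> = ((t - \<tau>) ^ k / fact k) *\<^sub>R \<phi> (Suc k) \<tau>" for \<tau>
    have "(R has_integral \<phi> 0 t - (\<Sum>i<Suc k. ((t - 0) ^ i / fact i) *\<^sub>R \<phi> i 0)) {0..t}"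
      using Taylor_has_integral[of "Suc k" \<phi> "\<phi> 0" 0 t] der t
      by (simp add: R_def[abs_def] del: fact_Suc)
    moreover have "norm (R \<tau>) \<le> t ^ k * (C * norm v ^ Suc k)" if "\<tau> \<in> cbox 0 t" for \<tau>
    proof -
      have "(t - \<tau>) ^ k / fact k \<le> t ^ k / 1"
        using that t by (intro frac_le power_mono) (auto simp: fact_ge_1)
      then show ?thesis
        unfolding R_def \<phi>_def norm_scaleR using that t
        by (intro mult_mono Cb ball) (auto simp: )
    qed
    ultimately have "norm (\<phi> 0 t - (\<Sum>i<Suc k. ((t - 0) ^ i / fact i) *\<^sub>R \<phi> i 0))
        \<le> t ^ k * (C * norm v ^ Suc k) * measure lborel (cbox 0 t)"
      using t C by (intro has_integral_bound) auto
    moreover have "(\<Sum>i<Suc k. ((t - 0) ^ i / fact i) *\<^sub>R \<phi> i 0) = (\<Sum>i\<le>k. t ^ i *\<^sub>R taylor_term i f v)"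
      by (simp add: taylor_term_def \<phi>_def lessThan_Suc_atMost divide_inverse)
    ultimately show ?thesis
      using t by (simp add: \<phi>_def power_mult_distrib mult_ac)
  qed
  with r(1) C show ?thesis by blast
qed

lemma jet_remainder:
  fixes f :: "'a::euclidean_space \<Rightarrow> 'b::banach"
  assumes "smooth_near0 f"
  shows "vanishes_to (Suc k) (\<lambda>x. f x - jet k f x)"
proof -
  obtain r C where "r > 0" and C: "\<And>t v. 0 \<le> t \<Longrightarrow> norm (t *\<^sub>R v) \<le> r \<Longrightarrow>
      norm (f (t *\<^sub>R v) - (\<Sum>i\<le>k. t ^ i *\<^sub>R taylor_term i f v)) \<le> C * norm (t *\<^sub>R v) ^ Suc k"
    using taylor_bound[OF assms, of k] by blast
  from C[of 1] show ?thesis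
    by (intro vanishes_toI[OF \<open>r > 0\<close>, of _ C]) (auto simp: jet_def)
qed

lemma jet_eq_imp_vanishes_to:
  fixes f g :: "'a::euclidean_space \<Rightarrow> 'b::banach"
  assumes "smooth_near0 f" "smooth_near0 g" "jet k f = jet k g"
  shows "vanishes_to (Suc k) (\<lambda>x. f x - g x)"
  using vanishes_to_add[OF jet_remainder[OF assms(1), of k] vanishes_to_minus[OF jet_remainder[OF assms(2), of k]]]
  by (simp add: assms(3))

text \<open>Letting \<open>t\<close> tend to \<open>0\<close> gives \<open>c 0 = 0\<close>; then divide by \<open>t\<close> and repeat.\<close>

lemma poly_coeffs_vanish:
  fixes c :: "nat \<Rightarrow> 'b::real_normed_vector"
  assumes "d > 0" "\<And>t. 0 < t \<Longrightarrow> t \<le> d \<Longrightarrow> norm (\<Sum>i\<le>k. t ^ i *\<^sub>R c i) \<le> C * t ^ Suc k" "i \<le> k"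
  shows "c i = 0"
  using assms(2,3)
proof (induction k arbitrary: c i)
  case (0 c i)
  have "((\<lambda>t. C * t) \<longlongrightarrow> C * 0) (at_right 0)" by (intro tendsto_intros)
  moreover have "\<forall>\<^sub>F t in at_right 0. norm (c 0) \<le> C * t"
    using \<open>d > 0\<close> 0 by (auto simp: eventually_at_right intro!: exI[of _ d])
  ultimately have "norm (c 0) \<le> C * 0"
    by (intro tendsto_le[OF _ _ tendsto_const]) auto
  then show ?case using 0 by simp
next
  case (Suc k c i)
  have peel: "(\<Sum>i\<le>Suc k. t ^ i *\<^sub>R c i) = c 0 + t *\<^sub>R (\<Sum>i\<le>k. t ^ i *\<^sub>R c (Suc i))" for t :: real
    by (simp only: sum.atMost_Suc_shift scaleR_sum_right) simp
  have "((\<lambda>t. norm (\<Sum>i\<le>Suc k. t ^ i *\<^sub>R c i)) \<longlongrightarrow> norm (\<Sum>i\<le>Suc k. 0 ^ i *\<^sub>R c i)) (at_right 0)"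
    by (intro tendsto_intros)
  moreover have "((\<lambda>t. C * t ^ Suc (Suc k)) \<longlongrightarrow> C * 0 ^ Suc (Suc k)) (at_right 0)" by (intro tendsto_intros)
  moreover have "\<forall>\<^sub>F t in at_right 0. norm (\<Sum>i\<le>Suc k. t ^ i *\<^sub>R c i) \<le> C * t ^ Suc (Suc k)"
    using \<open>d > 0\<close> Suc.prems(1) by (auto simp: eventually_at_right simp del: sum.atMost_Suc intro!: exI[of _ d])
  ultimately have "norm (\<Sum>i\<le>Suc k. 0 ^ i *\<^sub>R c i) \<le> C * 0 ^ Suc (Suc k)"
    by (intro tendsto_le[OF _]) auto
  then have c0: "c 0 = 0" by (simp add: peel del: sum.atMost_Suc)
  show ?case
  proof (cases i)
    case (Suc j)
    have "c (Suc j) = 0"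
    proof (rule Suc.IH[of "\<lambda>i. c (Suc i)"])
      show "norm (\<Sum>i\<le>k. t ^ i *\<^sub>R c (Suc i)) \<le> C * t ^ Suc k" if "0 < t" "t \<le> d" for t
        using Suc.prems(1)[OF that] that(1) by (simp add: peel c0 mult_ac del: sum.atMost_Suc)
      show "j \<le> k" using Suc.prems \<open>i = Suc j\<close> by simp
    qed
    then show ?thesis using Suc by simp
  qed (simp add: c0)
qed

text \<open>Along the ray through \<open>v\<close> the two Taylor polynomials differ by \<open>O(t\<^sup>k\<^sup>+\<^sup>1)\<close>, so their coefficients
  agree.\<close>

lemma vanishes_to_imp_taylor_term_eq:
  fixes f g :: "'a::euclidean_space \<Rightarrow> 'b::banach"
  assumes "smooth_near0 f" "smooth_near0 g" "vanishes_to (Suc k) (\<lambda>x. f x - g x)" "i \<le> k"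
  shows "taylor_term i f = taylor_term i g"
proof
  fix v :: 'a
  obtain r C where r: "r > 0" and C0: "C \<ge> 0" and C: "\<And>t v. 0 \<le> t \<Longrightarrow> norm (t *\<^sub>R v) \<le> r \<Longrightarrow>
      norm (f (t *\<^sub>R v) - (\<Sum>i\<le>k. t ^ i *\<^sub>R taylor_term i f v)) \<le> C * norm (t *\<^sub>R v) ^ Suc k"
    using taylor_bound[OF assms(1), of k] by blast
  obtain r' C' where r': "r' > 0" and C0': "C' \<ge> 0" and C': "\<And>t v. 0 \<le> t \<Longrightarrow> norm (t *\<^sub>R v) \<le> r' \<Longrightarrow>
      norm (g (t *\<^sub>R v) - (\<Sum>i\<le>k. t ^ i *\<^sub>R taylor_term i g v)) \<le> C' * norm (t *\<^sub>R v) ^ Suc k"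
    using taylor_bound[OF assms(2), of k] by blast
  obtain s D where s: "s > 0" "D \<ge> 0" and D: "\<And>x. norm x \<le> s \<Longrightarrow> norm (f x - g x) \<le> D * norm x ^ Suc k"
    using vanishes_toE[OF assms(3)] by blast
  define d where "d = min r (min r' s) / (norm v + 1)"
  have nv: "norm v + 1 > 0" using norm_ge_zero[of v] by linarith
  then have d: "d > 0" using r r' s by (simp add: d_def)
  have "taylor_term i f v - taylor_term i g v = 0"
  proof (rule poly_coeffs_vanish[OF d _ \<open>i \<le> k\<close>, of "\<lambda>i. taylor_term i f v - taylor_term i g v"])
    fix t :: real assume t: "0 < t" "t \<le> d"
    have "norm (t *\<^sub>R v) \<le> d * (norm v + 1)"
      using t by (auto intro: mult_mono)
    then have small: "norm (t *\<^sub>R v) \<le> min r (min r' s)"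
      using nv by (simp add: d_def)
    have "norm (f (t *\<^sub>R v) - (\<Sum>i\<le>k. t ^ i *\<^sub>R taylor_term i f v)) \<le> C * norm (t *\<^sub>R v) ^ Suc k"
      using small t by (intro C) auto
    moreover have "norm (g (t *\<^sub>R v) - (\<Sum>i\<le>k. t ^ i *\<^sub>R taylor_term i g v)) \<le> C' * norm (t *\<^sub>R v) ^ Suc k"
      using small t by (intro C') auto
    moreover have "norm (f (t *\<^sub>R v) - g (t *\<^sub>R v)) \<le> D * norm (t *\<^sub>R v) ^ Suc k"
      using small t by (intro D) auto
    moreover have "norm (y - z) \<le> norm (a - y) + norm (b - z) + norm (a - b)" for y z a b :: 'b
      using norm_triangle_ineq[of "y - a" "a - b"] norm_triangle_ineq[of "y - b" "b - z"]
      by (simp add: norm_minus_commute)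
    note this[of "\<Sum>i\<le>k. t ^ i *\<^sub>R taylor_term i f v" "\<Sum>i\<le>k. t ^ i *\<^sub>R taylor_term i g v"
        "f (t *\<^sub>R v)" "g (t *\<^sub>R v)"]
    ultimately have "norm ((\<Sum>i\<le>k. t ^ i *\<^sub>R taylor_term i f v) - (\<Sum>i\<le>k. t ^ i *\<^sub>R taylor_term i g v))
        \<le> (C + C' + D) * norm (t *\<^sub>R v) ^ Suc k"
      unfolding distrib_right by linarith
    then show "norm (\<Sum>i\<le>k. t ^ i *\<^sub>R (taylor_term i f v - taylor_term i g v))
        \<le> ((C + C' + D) * norm v ^ Suc k) * t ^ Suc k"
      using t by (simp add: scaleR_diff_right sum_subtractf power_mult_distrib mult_ac)
  qed
  then show "taylor_term i f v = taylor_term i g v" by simp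
qed

lemma vanishes_to_imp_jet_eq:
  fixes f g :: "'a::euclidean_space \<Rightarrow> 'b::banach"
  assumes "smooth_near0 f" "smooth_near0 g" "vanishes_to (Suc k) (\<lambda>x. f x - g x)"
  shows "jet k f = jet k g"
proof
  fix x
  show "jet k f x = jet k g x"
    unfolding jet_def
  proof (rule sum.cong[OF refl])
    fix i assume "i \<in> {..k}"
    then have "taylor_term i f = taylor_term i g"
      by (intro vanishes_to_imp_taylor_term_eq[OF assms]) simp
    then show "taylor_term i f x = taylor_term i g x" by (rule fun_cong)
  qed
qed

lemma smooth_near0_vanishes_to_1:
  fixes f :: "'a::euclidean_space \<Rightarrow> 'b::banach"
  assumes "smooth_near0 f" "f 0 = 0"
  shows "vanishes_to 1 f"
  using jet_remainder[OF assms(1), of 0] assms(2) by (simp add: jet_def taylor_term_def)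

section \<open>Existence and uniqueness of the flow\<close>

text \<open>This is the estimate that makes Picard iteration a contraction on the whole real line once
  functions are measured in the weighted norm \<open>sup exp (- K \<bar>s\<bar>) \<bar>f s\<bar>\<close>. Both signs of \<open>s\<close> are treated
  at once by following \<open>u \<mapsto> A (s u)\<close> on \<open>[0, 1]\<close>.\<close>

lemma exponential_growth_bound:
  fixes A a :: "real \<Rightarrow> 'a::real_normed_vector"
  assumes der: "\<And>\<tau>. (A has_vector_derivative a \<tau>) (at \<tau>)" and "A 0 = 0"
    and le: "\<And>\<tau>. norm (a \<tau>) \<le> c * exp (K * \<bar>\<tau>\<bar>)" and "K > 0" 
  shows "norm (A s) \<le> c / K * exp (K * \<bar>s\<bar>)"
proof -
  have c0: "c \<ge> 0" using le[of 0] norm_ge_zero[of "a 0"] by (simp del: norm_ge_zero)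
  define k where "k = K * \<bar>s\<bar>"
  have "norm (A (s * 1) - A (s * 0)) \<le> c / K * exp (k * 1) - c / K * exp (k * 0)"
  proof (rule differentiable_bound_general[where f = "\<lambda>u. A (s * u)" and f' = "\<lambda>u. s *\<^sub>R a (s * u)"
        and \<phi> = "\<lambda>u. c / K * exp (k * u)" and \<phi>' = "\<lambda>u. c / K * (k * exp (k * u))"])
    have d: "((\<lambda>u. A (s * u)) has_vector_derivative s *\<^sub>R a (s * u)) (at u)" for u
    proof -
      have "((\<lambda>u. s * u) has_vector_derivative s) (at u)"
        by (auto intro!: derivative_eq_intros)
      from vector_diff_chain_at[OF this der] show ?thesis by (simp add: o_def)
    qed
    then show "((\<lambda>u. A (s * u)) has_vector_derivative s *\<^sub>R a (s * u)) (at u)" for u .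
    show "continuous_on {0..1} (\<lambda>u. A (s * u))"
      by (intro continuous_at_imp_continuous_on ballI has_vector_derivative_continuous[OF d])
    show "((\<lambda>u. c / K * exp (k * u)) has_vector_derivative c / K * (k * exp (k * u))) (at u)" for u
      unfolding has_real_derivative_iff_has_vector_derivative[symmetric]
      using \<open>K > 0\<close> by (auto intro!: derivative_eq_intros)
    show "norm (s *\<^sub>R a (s * u)) \<le> c / K * (k * exp (k * u))" if "0 < u" "u < 1" for u
    proof -
      have "norm (s *\<^sub>R a (s * u)) \<le> \<bar>s\<bar> * (c * exp (K * \<bar>s * u\<bar>))"
        by (simp add: mult_left_mono le)
      also have "\<dots> = c / K * (k * exp (k * u))"
        using that \<open>K > 0\<close> by (simp add: k_def abs_mult mult_ac)
      finally show ?thesis .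
    qed
  qed (use \<open>K > 0\<close> in \<open>auto intro!: continuous_intros\<close>)
  moreover have "c / K \<ge> 0" using c0 \<open>K > 0\<close> by simp
  ultimately show ?thesis using \<open>A 0 = 0\<close> by (simp add: k_def algebra_simps)
qed

text \<open>Picard iteration. A solution is sought in the form \<open>\<gamma> s = x + exp (K \<bar>s\<bar>) u s\<close> with \<open>u\<close> bounded and
  continuous. With this exponential weight the integral operator contracts by the factor \<open>\<bar>M\<bar> / K\<close>
  on all of \<open>\<real>\<close>, so a single application of the Banach fixed point theorem yields a solution for all
  times of both signs.\<close>

lemma global_solution_exists:
  fixes F :: "'a::euclidean_space \<Rightarrow> 'a"
  assumes lip: "\<And>x y. norm (F x - F y) \<le> M * norm (x - y)"
  shows "\<exists>\<gamma>. \<gamma> 0 = x \<and> (\<forall>s::real. (\<gamma> has_vector_derivative F (\<gamma> s)) (at s))"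
proof -
  \<comment> \<open>chosen so that the contraction factor below is at most one half\<close>
  define K where "K = 2 * \<bar>M\<bar> + 1"
  have K: "K > 0" "\<bar>M\<bar> / K \<le> 1/2" by (auto simp: K_def divide_simps)
  have lip': "norm (F x - F y) \<le> \<bar>M\<bar> * norm (x - y)" for x y
    by (rule order_trans[OF lip]) (simp add: mult_right_mono)
  have contF: "continuous_on UNIV F"
  proof -
    have "\<bar>M\<bar>-lipschitz_on UNIV F"
      by (rule lipschitz_onI) (auto simp: dist_norm lip')
    then show ?thesis by (rule lipschitz_on_continuous_on)
  qed
  define f where "f u \<tau> = F (x + exp (K * \<bar>\<tau>\<bar>) *\<^sub>R apply_bcontfun u \<tau>)" for u and \<tau> :: real
  have contf: "continuous_on UNIV (f u)" for u
    unfolding f_def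
    by (intro continuous_on_compose2[OF contF] continuous_intros) auto
  have "\<exists>A. A 0 = 0 \<and> (\<forall>s. (A has_vector_derivative f u s) (at s))" for u
  proof -
    obtain A where A: "\<And>s. (A has_vector_derivative f u s) (at s)"
      using einterval_antiderivative[of "-\<infinity>" "\<infinity>" "f u"] contf[of u]
      by (auto simp: continuous_on_eq_continuous_at)
    show ?thesis
      by (rule exI[of _ "\<lambda>s. A s - A 0"]) (auto intro!: derivative_eq_intros A)
  qed
  then obtain A where A0: "\<And>u. A u 0 = 0"
    and A: "\<And>u s. (A u has_vector_derivative f u s) (at s)" by metis
  have f_le: "norm (f u \<tau>) \<le> (norm (F x) + \<bar>M\<bar> * dist u 0) * exp (K * \<bar>\<tau>\<bar>)" for u \<tau>
  proof -
    have "norm (f u \<tau>) \<le> norm (F x) + norm (f u \<tau> - F x)" by norm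
    also have "norm (f u \<tau> - F x) \<le> \<bar>M\<bar> * (exp (K * \<bar>\<tau>\<bar>) * dist u 0)"
      unfolding f_def using dist_bounded[of u \<tau> 0]
      by (intro order_trans[OF lip'] mult_left_mono) auto
    also have "norm (F x) \<le> norm (F x) * exp (K * \<bar>\<tau>\<bar>)"
      using K by (simp add: mult_le_cancel_left1)
    finally show ?thesis by (simp add: algebra_simps)
  qed
  define \<Phi> where "\<Phi> u s = exp (- (K * \<bar>s\<bar>)) *\<^sub>R A u s" for u s
  \<comment> \<open>passing from an exponential bound to a bound in the weighted norm\<close>
  have weight: "norm (exp (- (K * \<bar>s\<bar>)) *\<^sub>R y) \<le> c" if "norm y \<le> c * exp (K * \<bar>s\<bar>)" for y :: 'a and c s
    using mult_left_mono[OF that, of "exp (- (K * \<bar>s\<bar>))"] by (simp add: exp_minus field_simps)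
  have "\<Phi> u \<in> bcontfun" for u
  proof -
    have "continuous_on UNIV (A u)"
      by (meson A continuous_at_imp_continuous_on has_vector_derivative_continuous)
    then have "continuous_on UNIV (\<Phi> u)"
      unfolding \<Phi>_def by (intro continuous_intros)
    moreover have "norm (\<Phi> u s) \<le> (norm (F x) + \<bar>M\<bar> * dist u 0) / K" for s
      unfolding \<Phi>_def by (intro weight exponential_growth_bound[OF A A0 f_le K(1)])
    then have "bounded (range (\<Phi> u))"
      by (auto simp: bounded_iff)
    ultimately show ?thesis by (simp add: bcontfun_def)
  qed
  then have app: "apply_bcontfun (Bcontfun (\<Phi> u)) = \<Phi> u" for u
    by (rule Bcontfun_inverse)
  have "dist (Bcontfun (\<Phi> u)) (Bcontfun (\<Phi> v)) \<le> 1/2 * dist u v" for u v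
  proof (rule dist_bound)
    fix s
    have "norm (f u \<tau> - f v \<tau>) \<le> (\<bar>M\<bar> * dist u v) * exp (K * \<bar>\<tau>\<bar>)" for \<tau>
    proof -
      have "norm (f u \<tau> - f v \<tau>) \<le> \<bar>M\<bar> * (exp (K * \<bar>\<tau>\<bar>) * dist u v)"
        unfolding f_def using dist_bounded[of u \<tau> v]
        by (intro order_trans[OF lip'] mult_left_mono)
          (auto simp: dist_norm simp flip: scaleR_diff_right)
      then show ?thesis by (simp add: algebra_simps)
    qed
    then have "norm (A u s - A v s) \<le> (\<bar>M\<bar> * dist u v) / K * exp (K * \<bar>s\<bar>)"
      by (intro exponential_growth_bound[where a = "\<lambda>\<tau>. f u \<tau> - f v \<tau>"] K)
        (auto intro!: derivative_eq_intros A simp: A0)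
    then have "norm (\<Phi> u s - \<Phi> v s) \<le> (\<bar>M\<bar> * dist u v) / K"
      unfolding \<Phi>_def scaleR_diff_right[symmetric] by (rule weight)
    also have "\<dots> \<le> 1/2 * dist u v"
      using mult_right_mono[OF K(2), of "dist u v"] by simp
    finally show "dist (apply_bcontfun (Bcontfun (\<Phi> u)) s) (apply_bcontfun (Bcontfun (\<Phi> v)) s)
        \<le> 1/2 * dist u v"
      by (simp add: app dist_norm)
  qed
  then obtain u where u: "Bcontfun (\<Phi> u) = u"
    using banach_fix_type[of "1/2" "\<lambda>u. Bcontfun (\<Phi> u)"] by auto
  \<comment> \<open>the fixed point equation says that the curve is the integral of the field along itself\<close>
  have "x + exp (K * \<bar>s\<bar>) *\<^sub>R apply_bcontfun u s = x + A u s" for s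
    by (subst u[symmetric]) (simp add: app \<Phi>_def exp_minus)
  then have "f u s = F (x + A u s)" for s
    by (simp add: f_def)
  then have "((\<lambda>s. x + A u s) has_vector_derivative F (x + A u s)) (at s)" for s
    using A[of u s] by (auto intro!: derivative_eq_intros)
  then show ?thesis
    by (intro exI[of _ "\<lambda>s. x + A u s"]) (simp add: A0)
qed

text \<open>Substituting \<open>s = t \<sigma>\<close> reduces both signs of \<open>t\<close> to the interval \<open>[0, 1]\<close>. There the squared norm,
  discounted by the square of the expected growth, has a nonpositive derivative.\<close>

lemma gronwall:
  fixes u u' :: "real \<Rightarrow> 'a::real_inner"
  assumes der: "\<And>s. s \<in> closed_segment 0 t \<Longrightarrow>
      (u has_vector_derivative u' s) (at s within closed_segment 0 t)"
    and le: "\<And>s. s \<in> closed_segment 0 t \<Longrightarrow> norm (u' s) \<le> M * norm (u s)"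
  shows "norm (u t) \<le> norm (u 0) * exp (M * \<bar>t\<bar>)"
proof -
  define k where "k = M * \<bar>t\<bar>"
  define v v' where "v \<sigma> = u (t * \<sigma>)" and "v' \<sigma> = t *\<^sub>R u' (t * \<sigma>)" for \<sigma>
  have seg: "t * \<sigma> \<in> closed_segment 0 t" if "\<sigma> \<in> {0..1}" for \<sigma>
    using that by (auto simp: closed_segment_def mult.commute)
  have dv: "(v has_vector_derivative v' \<sigma>) (at \<sigma> within {0..1})" if "\<sigma> \<in> {0..1}" for \<sigma>
  proof -
    have "((\<lambda>\<sigma>. t * \<sigma>) has_vector_derivative t) (at \<sigma> within {0..1})"
      by (auto intro!: derivative_eq_intros)
    moreover have "(u has_vector_derivative u' (t * \<sigma>)) (at (t * \<sigma>) within (\<lambda>\<sigma>. t * \<sigma>) ` {0..1})"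
      using seg by (intro has_vector_derivative_within_subset[OF der[OF seg[OF that]]]) auto
    ultimately show ?thesis
      unfolding v_def v'_def using vector_diff_chain_within by (fastforce simp: o_def)
  qed
  \<comment> \<open>the square of the norm is differentiable also where the norm vanishes\<close>
  define \<phi> where "\<phi> \<sigma> = (v \<sigma> \<bullet> v \<sigma>) * exp (- 2 * k * \<sigma>)" for \<sigma>
  have "\<phi> 1 \<le> \<phi> 0"
  proof (rule DERIV_nonpos_imp_decreasing_open[where a = 0 and b = 1 and f = \<phi>])
    show "(0::real) \<le> 1" by simp
  next
    fix \<sigma> :: real assume that: "0 < \<sigma>" "\<sigma> < 1"
    show "\<exists>y. DERIV \<phi> \<sigma> :> y \<and> y \<le> 0"
    proof -
      have s: "\<sigma> \<in> {0..1}" using that by simp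
      have "(v has_vector_derivative v' \<sigma>) (at \<sigma>)"
        using dv[OF s] that at_within_interior[of \<sigma> "{0..1}"] by simp
      then have "(v has_derivative (\<lambda>h. h *\<^sub>R v' \<sigma>)) (at \<sigma>)"
        by (simp add: has_vector_derivative_def)
      then have "(\<phi> has_derivative (\<lambda>h. h * ((2 * (v \<sigma> \<bullet> v' \<sigma>) - 2 * k * (v \<sigma> \<bullet> v \<sigma>)) * exp (- 2 * k * \<sigma>)))) (at \<sigma>)"
        unfolding \<phi>_def by (auto intro!: derivative_eq_intros simp: algebra_simps inner_commute)
      then have "DERIV \<phi> \<sigma> :> (2 * (v \<sigma> \<bullet> v' \<sigma>) - 2 * k * (v \<sigma> \<bullet> v \<sigma>)) * exp (- 2 * k * \<sigma>)"
        by (simp add: has_field_derivative_def mult_commute_abs)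
      moreover have "v \<sigma> \<bullet> v' \<sigma> \<le> k * (v \<sigma> \<bullet> v \<sigma>)"
      proof -
        have v': "norm (v' \<sigma>) \<le> \<bar>t\<bar> * (M * norm (v \<sigma>))"
          unfolding v'_def v_def using le[OF seg[OF s]] by (simp add: mult_left_mono)
        have "v \<sigma> \<bullet> v' \<sigma> \<le> norm (v \<sigma>) * norm (v' \<sigma>)" by (rule norm_cauchy_schwarz)
        also have "\<dots> \<le> norm (v \<sigma>) * (\<bar>t\<bar> * (M * norm (v \<sigma>)))"
          by (intro mult_left_mono v') simp
        finally show ?thesis
          by (simp add: k_def dot_square_norm power2_eq_square mult_ac)
      qed
      ultimately show ?thesis
        by (intro exI[of _ "(2 * (v \<sigma> \<bullet> v' \<sigma>) - 2 * k * (v \<sigma> \<bullet> v \<sigma>)) * exp (- 2 * k * \<sigma>)"])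
          (simp add: mult_le_0_iff)
    qed
  next
    have "continuous_on {0..1} v"
      unfolding continuous_on_eq_continuous_within
      by (intro ballI has_vector_derivative_continuous[OF dv])
    then show "continuous_on {0..1} \<phi>"
      unfolding \<phi>_def by (intro continuous_intros)
  qed
  then have "(norm (u t))\<^sup>2 * exp (- 2 * k) \<le> (norm (u 0))\<^sup>2"
    by (simp add: \<phi>_def v_def dot_square_norm)
  then have "(norm (u t))\<^sup>2 \<le> (norm (u 0) * exp k)\<^sup>2"
    by (simp add: power_mult_distrib exp_minus divide_simps mult.commute flip: exp_double)
  then show ?thesis
    unfolding k_def by (rule power2_le_imp_le) simp
qed

text \<open>The curve \<open>\<delta>\<close> may leave the ball on which \<open>F\<close> is Lipschitz, but the inequality
  \<open>\<bar>F (\<delta> s) - F (\<gamma> s)\<bar> \<le> N \<bar>\<delta> s - \<gamma> s\<bar>\<close> still holds along the two curves: if they are close at time \<open>s\<close>,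
  both points lie in the ball, and if they are far apart, it suffices that \<open>F\<close> is bounded along both.
  Gronwall's inequality does the rest.\<close>

lemma integral_curve_unique:
  fixes F :: "'a::euclidean_space \<Rightarrow> 'a"
  assumes "r > 0" and contF: "continuous_on W F"
    and lip: "\<And>x y. norm x \<le> r \<Longrightarrow> norm y \<le> r \<Longrightarrow> norm (F x - F y) \<le> M * norm (x - y)"
    and 1: "integral_curve W F x t \<gamma>" and small: "\<And>s. s \<in> closed_segment 0 t \<Longrightarrow> norm (\<gamma> s) \<le> r / 2"
    and 2: "integral_curve W F x t \<delta>"
  shows "\<delta> t = \<gamma> t"
proof -
  let ?S = "closed_segment 0 t"
  have bdd: "\<exists>B. \<forall>s\<in>?S. norm (F (\<eta> s)) \<le> B" if "integral_curve W F x t \<eta>" for \<eta>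
  proof -
    have "continuous_on ?S \<eta>"
      using that unfolding continuous_on_eq_continuous_within integral_curve_def
      by (blast intro: has_vector_derivative_continuous)
    then have "continuous_on ?S (\<lambda>s. F (\<eta> s))"
      using that by (intro continuous_on_compose2[OF contF]) (auto simp: integral_curve_def)
    then have "bounded ((\<lambda>s. F (\<eta> s)) ` ?S)"
      by (intro compact_imp_bounded compact_continuous_image) auto
    then show ?thesis by (auto simp: bounded_iff)
  qed
  obtain B C where B: "\<And>s. s \<in> ?S \<Longrightarrow> norm (F (\<gamma> s)) \<le> B"
    and C: "\<And>s. s \<in> ?S \<Longrightarrow> norm (F (\<delta> s)) \<le> C"
    using bdd[OF 1] bdd[OF 2] by blast
  have BC: "0 \<le> B + C" using order_trans[OF norm_ge_zero B, of 0] order_trans[OF norm_ge_zero C, of 0] by simp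
  \<comment> \<open>the second summand covers the times at which the curves are more than \<open>r / 2\<close> apart\<close>
  define N where "N = \<bar>M\<bar> + 2 * (B + C) / r"
  have "norm (\<delta> t - \<gamma> t) \<le> norm (\<delta> 0 - \<gamma> 0) * exp (N * \<bar>t\<bar>)"
  proof (rule gronwall[where u = "\<lambda>s. \<delta> s - \<gamma> s" and u' = "\<lambda>s. F (\<delta> s) - F (\<gamma> s)"])
    fix s assume s: "s \<in> ?S"
    show "((\<lambda>s. \<delta> s - \<gamma> s) has_vector_derivative F (\<delta> s) - F (\<gamma> s)) (at s within ?S)"
      using 1 2 s by (intro has_vector_derivative_diff) (auto simp: integral_curve_def)
    show "norm (F (\<delta> s) - F (\<gamma> s)) \<le> N * norm (\<delta> s - \<gamma> s)"
    proof (cases "norm (\<delta> s - \<gamma> s) \<le> r / 2")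
      case True
      then have "norm (\<delta> s) \<le> r" using small[OF s] norm_triangle_sub[of "\<delta> s" "\<gamma> s"] by simp
      then have "norm (F (\<delta> s) - F (\<gamma> s)) \<le> M * norm (\<delta> s - \<gamma> s)"
        using small[OF s] \<open>r > 0\<close> by (intro lip) auto
      also have "\<dots> \<le> N * norm (\<delta> s - \<gamma> s)"
        using BC \<open>r > 0\<close> by (intro mult_right_mono) (auto simp: N_def intro: add_increasing2)
      finally show ?thesis .
    next
      case False
      have "norm (F (\<delta> s) - F (\<gamma> s)) \<le> B + C"
        using B[OF s] C[OF s] norm_triangle_ineq4[of "F (\<delta> s)" "F (\<gamma> s)"] by simp
      also have "\<dots> = 2 * (B + C) / r * (r / 2)" using \<open>r > 0\<close> by simp
      also have "\<dots> \<le> N * norm (\<delta> s - \<gamma> s)"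
        using BC \<open>r > 0\<close> False by (intro mult_mono) (auto simp: N_def)
      finally show ?thesis .
    qed
  qed
  then show ?thesis using 1 2 by (simp add: integral_curve_def)
qed

text \<open>A global flow \<open>\<Gamma>\<close> that represents the local flow of \<open>F\<close> for those points and times for which the growth
  estimate keeps the trajectory in a small ball. The group law holds
  for all points and times, and domain conditions occur only where \<open>\<Gamma>\<close> is compared with \<open>F\<close>.\<close>

locale flow_near_zero =
  fixes W :: "'a::euclidean_space set" and F :: "'a \<Rightarrow> 'a" and r M :: real and \<Gamma> :: "'a \<Rightarrow> real \<Rightarrow> 'a"
  assumes radius_pos: "r > 0" and rate_nonneg: "M \<ge> 0"
    and local_flow_eq: "norm x * exp (M * \<bar>t\<bar>) \<le> r \<Longrightarrow> local_flow W F x t = \<Gamma> x t"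
    and flow_derivative: "norm x * exp (M * \<bar>t\<bar>) \<le> r \<Longrightarrow> (\<Gamma> x has_vector_derivative F (\<Gamma> x t)) (at t)"
    and flow_growth: "norm (\<Gamma> x t) \<le> norm x * exp (M * \<bar>t\<bar>)"
    and flow_add: "\<Gamma> (\<Gamma> x s) t = \<Gamma> x (s + t)"

text \<open>Composing \<open>F\<close> with the nearest-point projection onto a closed ball makes it globally Lipschitz
  without changing it on the ball, so the modified field has a global flow. Trajectories of the two
  fields that stay in the ball coincide.\<close>

lemma flow_near_zero_exists:
  fixes F :: "'a::euclidean_space \<Rightarrow> 'a"
  assumes "open W" "0 \<in> W" "smooth_on W F" "F 0 = 0"
  shows "\<exists>r M \<Gamma>. flow_near_zero W F r M \<Gamma>"
proof -
  obtain R where R: "R > 0" "cball 0 R \<subseteq> W"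
    using assms(1,2) by (meson open_contains_cball)
  obtain M where M: "M \<ge> 0"
    and lip: "\<And>x y. x \<in> cball 0 R \<Longrightarrow> y \<in> cball 0 R \<Longrightarrow> norm (F x - F y) \<le> M * norm (x - y)"
    using smooth_on_lipschitz[OF assms(1) compact_cball convex_cball R(2) assms(3)] by blast
  define P where "P = closest_point (cball (0::'a) R)"
  have ne: "cball (0::'a) R \<noteq> {}" using R by simp
  have P_in: "P y \<in> cball 0 R" for y
    unfolding P_def by (intro closest_point_in_set ne closed_cball)
  have P_id: "P y = y" if "norm y \<le> R" for y
    unfolding P_def using that by (intro closest_point_self) simp
  have P_lip: "norm (P x - P y) \<le> norm (x - y)" for x y
    unfolding P_def dist_norm[symmetric] by (intro closest_point_lipschitz ne convex_cball closed_cball)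
  define H where "H y = F (P y)" for y
  have H_lip: "norm (H x - H y) \<le> M * norm (x - y)" for x y
    unfolding H_def by (rule order_trans[OF lip[OF P_in P_in]]) (simp add: M P_lip mult_left_mono)
  have H0: "H 0 = 0" using R P_id[of 0] by (simp add: H_def assms(4))
  have "\<exists>\<gamma>. \<gamma> 0 = x \<and> (\<forall>s. (\<gamma> has_vector_derivative H (\<gamma> s)) (at s))" for x
    by (rule global_solution_exists[OF H_lip])
  then obtain \<Gamma> where \<Gamma>0: "\<And>x. \<Gamma> x 0 = x"
    and \<Gamma>: "\<And>x s. (\<Gamma> x has_vector_derivative H (\<Gamma> x s)) (at s)"
    by metis
  have growth: "norm (\<Gamma> x t) \<le> norm x * exp (M * \<bar>t\<bar>)" for x t
  proof -
    have "norm (\<Gamma> x t) \<le> norm (\<Gamma> x 0) * exp (M * \<bar>t\<bar>)"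
    proof (rule gronwall)
      show "(\<Gamma> x has_vector_derivative H (\<Gamma> x s)) (at s within closed_segment 0 t)" for s
        by (rule has_vector_derivative_at_within[OF \<Gamma>])
      show "norm (H (\<Gamma> x s)) \<le> M * norm (\<Gamma> x s)" for s
        using H_lip[of "\<Gamma> x s" 0] by (simp add: H0)
    qed
    then show ?thesis by (simp add: \<Gamma>0)
  qed
  have group: "\<Gamma> (\<Gamma> x s) t = \<Gamma> x (s + t)" for x s t
  proof -
    have shifted: "((\<lambda>\<tau>. \<Gamma> x (s + \<tau>)) has_vector_derivative H (\<Gamma> x (s + \<tau>))) (at \<tau>)" for \<tau>
    proof -
      have "((\<lambda>\<tau>. s + \<tau>) has_vector_derivative 1) (at \<tau>)"
        by (auto intro!: derivative_eq_intros)
      from vector_diff_chain_at[OF this \<Gamma>] show ?thesis by (simp add: o_def)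
    qed
    have "norm (\<Gamma> (\<Gamma> x s) t - \<Gamma> x (s + t)) \<le> norm (\<Gamma> (\<Gamma> x s) 0 - \<Gamma> x (s + 0)) * exp (M * \<bar>t\<bar>)"
      by (rule gronwall[where u = "\<lambda>\<tau>. \<Gamma> (\<Gamma> x s) \<tau> - \<Gamma> x (s + \<tau>)"
            and u' = "\<lambda>\<tau>. H (\<Gamma> (\<Gamma> x s) \<tau>) - H (\<Gamma> x (s + \<tau>))"])
        (intro H_lip has_vector_derivative_diff has_vector_derivative_at_within[OF \<Gamma>]
          has_vector_derivative_at_within[OF shifted])+
    then show ?thesis by (simp add: \<Gamma>0)
  qed
  have HF: "H (\<Gamma> x t) = F (\<Gamma> x t)" if "norm x * exp (M * \<bar>t\<bar>) \<le> R / 2" for x t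
    using growth[of x t] that R(1) by (simp add: H_def P_id)
  have flow: "local_flow W F x t = \<Gamma> x t" if le: "norm x * exp (M * \<bar>t\<bar>) \<le> R / 2" for x t
  proof -
    have le_s: "norm x * exp (M * \<bar>s\<bar>) \<le> R / 2" if "s \<in> closed_segment 0 t" for s
    proof -
      have "\<bar>s\<bar> \<le> \<bar>t\<bar>" using that by (auto simp: closed_segment_eq_real_ivl split: if_splits)
      then have "norm x * exp (M * \<bar>s\<bar>) \<le> norm x * exp (M * \<bar>t\<bar>)"
        using M by (intro mult_left_mono) (auto intro: mult_left_mono)
      then show ?thesis using le by simp
    qed
    then have small: "norm (\<Gamma> x s) \<le> R / 2" if "s \<in> closed_segment 0 t" for s
      using growth[of x s] that by (meson order_trans)
    have curve: "integral_curve W F x t (\<Gamma> x)"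
      unfolding integral_curve_def
    proof (intro conjI ballI)
      fix s assume s: "s \<in> closed_segment 0 t"
      show "\<Gamma> x s \<in> W" using small[OF s] R by auto
      show "(\<Gamma> x has_vector_derivative F (\<Gamma> x s)) (at s within closed_segment 0 t)"
        using \<Gamma>[of x s] HF[OF le_s[OF s]] by (simp add: has_vector_derivative_at_within)
    qed (rule \<Gamma>0)
    show ?thesis
      unfolding local_flow_def
    proof (rule the_equality)
      fix y assume "\<exists>\<gamma>. integral_curve W F x t \<gamma> \<and> \<gamma> t = y"
      then obtain \<gamma> where \<gamma>: "integral_curve W F x t \<gamma>" "\<gamma> t = y" by blast
      have "\<gamma> t = \<Gamma> x t"
        by (rule integral_curve_unique[OF R(1) smooth_on_continuous[OF assms(3)] _ curve small \<gamma>(1)])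
          (use lip in auto)
      then show "y = \<Gamma> x t" using \<gamma>(2) by simp
    qed (use curve in blast)
  qed
  \<comment> \<open>half the radius leaves the margin that the uniqueness argument requires\<close>
  have "flow_near_zero W F (R / 2) M \<Gamma>"
  proof
    show "(\<Gamma> x has_vector_derivative F (\<Gamma> x t)) (at t)" if "norm x * exp (M * \<bar>t\<bar>) \<le> R / 2" for x t
      using \<Gamma>[of x t] HF[OF that] by simp
  qed (use R(1) M flow growth group in auto)
  then show ?thesis by blast
qed

section \<open>Shifts along the flow\<close>

context flow_near_zero
begin

lemma eventually_small:
  assumes "\<rho> > 0"
  shows "\<forall>\<^sub>F x in nhds (0::'a). \<forall>t. \<bar>t\<bar> \<le> T \<longrightarrow> norm x * exp (M * \<bar>t\<bar>) \<le> \<rho>"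
proof -
  have "norm x * exp (M * \<bar>t\<bar>) \<le> \<rho>" if x: "norm x < \<rho> / exp (M * T)" and t: "\<bar>t\<bar> \<le> T"
    for x :: 'a and t :: real
  proof -
    have "norm x * exp (M * \<bar>t\<bar>) \<le> \<rho> / exp (M * T) * exp (M * T)"
      using x t assms rate_nonneg by (intro mult_mono) (auto intro: mult_left_mono)
    then show ?thesis by simp
  qed
  then show ?thesis
    using assms unfolding eventually_nhds_metric
    by (intro exI[of _ "\<rho> / exp (M * T)"]) auto
qed

lemma shift_vanishes_to:
  assumes "vanishes_to 0 \<alpha>"
  shows "vanishes_to 1 (shift W F \<alpha>)"
proof -
  obtain T where "\<forall>\<^sub>F x in nhds 0. norm (\<alpha> x) \<le> T * norm x ^ 0"
    using assms unfolding vanishes_to_def by blast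
  with eventually_small[OF radius_pos, of T]
  have "\<forall>\<^sub>F x in nhds 0. norm (shift W F \<alpha> x) \<le> exp (M * T) * norm x ^ 1"
  proof eventually_elim
    case (elim x)
    then have T: "\<bar>\<alpha> x\<bar> \<le> T" by simp
    have "norm (shift W F \<alpha> x) \<le> norm x * exp (M * \<bar>\<alpha> x\<bar>)"
      using elim(1) T by (simp add: shift_def local_flow_eq flow_growth)
    also have "\<dots> \<le> norm x * exp (M * T)"
      using T rate_nonneg by (intro mult_left_mono) (auto intro: mult_left_mono)
    finally show ?case by (simp add: mult.commute)
  qed
  then show ?thesis unfolding vanishes_to_def by blast
qed

text \<open>The two points lie on one trajectory, along which the speed is \<open>O(\<bar>x\<bar>\<^sup>p)\<close> for bounded times; their
  distance is at most the speed times the difference of the times.\<close>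

lemma shift_diff_vanishes_to:
  assumes \<alpha>: "vanishes_to 0 \<alpha>" and \<beta>: "vanishes_to 0 \<beta>"
    and Fp: "vanishes_to p F" and diff: "vanishes_to l (\<lambda>x. \<alpha> x - \<beta> x)"
  shows "vanishes_to (p + l) (\<lambda>x. shift W F \<alpha> x - shift W F \<beta> x)"
proof -
  obtain c C where c: "c > 0" "C \<ge> 0" "\<And>x. norm x \<le> c \<Longrightarrow> norm (F x) \<le> C * norm x ^ p"
    using vanishes_toE[OF Fp] by blast
  obtain D where D: "\<forall>\<^sub>F x in nhds 0. norm (\<alpha> x - \<beta> x) \<le> D * norm x ^ l"
    using diff unfolding vanishes_to_def by blast
  obtain A B where "\<forall>\<^sub>F x in nhds 0. norm (\<alpha> x) \<le> A * norm x ^ 0"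
    and "\<forall>\<^sub>F x in nhds 0. norm (\<beta> x) \<le> B * norm x ^ 0"
    using \<alpha> \<beta> unfolding vanishes_to_def by blast
  moreover define T where "T = max A B"
  have "min r c > 0" using radius_pos c(1) by simp
  note eventually_small[OF this, of T]
  ultimately have "\<forall>\<^sub>F x in nhds 0. norm (shift W F \<alpha> x - shift W F \<beta> x)
      \<le> (C * exp (M * T) ^ p * D) * norm x ^ (p + l)"
    using D
  proof eventually_elim
    case (elim x)
    have t: "\<bar>\<alpha> x\<bar> \<le> T" "\<bar>\<beta> x\<bar> \<le> T" using elim(1,2) by (auto simp: T_def)
    have "norm (\<Gamma> x (\<alpha> x) - \<Gamma> x (\<beta> x)) \<le> C * (norm x * exp (M * T)) ^ p * norm (\<alpha> x - \<beta> x)"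
    proof (rule differentiable_bound)
      show "convex {-T..T}" by simp
      fix \<tau> assume "\<tau> \<in> {-T..T}"
      then have \<tau>: "\<bar>\<tau>\<bar> \<le> T" by auto
      then have small: "norm x * exp (M * \<bar>\<tau>\<bar>) \<le> min r c" using elim(3) by blast
      then have "(\<Gamma> x has_vector_derivative F (\<Gamma> x \<tau>)) (at \<tau> within {-T..T})"
        by (intro has_vector_derivative_at_within[OF flow_derivative]) simp
      then show "(\<Gamma> x has_derivative (\<lambda>h. h *\<^sub>R F (\<Gamma> x \<tau>))) (at \<tau> within {-T..T})"
        by (simp add: has_vector_derivative_def)
      have "norm (\<Gamma> x \<tau>) \<le> norm x * exp (M * T)"
        using \<tau> rate_nonneg by (intro order_trans[OF flow_growth] mult_left_mono) (auto intro: mult_left_mono)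
      moreover have "norm (\<Gamma> x \<tau>) \<le> c" using small flow_growth[of x \<tau>] by simp
      ultimately have "norm (F (\<Gamma> x \<tau>)) \<le> C * (norm x * exp (M * T)) ^ p"
        using c(2) by (intro order_trans[OF c(3)] mult_left_mono power_mono) auto
      then show "onorm (\<lambda>h. h *\<^sub>R F (\<Gamma> x \<tau>)) \<le> C * (norm x * exp (M * T)) ^ p"
        using c(2) by (intro onorm_bound) (simp_all add: mult.commute[of "\<bar>_\<bar>"] mult_right_mono)
    qed (use t in auto)
    also have "\<dots> \<le> C * (norm x * exp (M * T)) ^ p * (D * norm x ^ l)"
      using elim(4) c(2) by (intro mult_left_mono) auto
    finally have "norm (\<Gamma> x (\<alpha> x) - \<Gamma> x (\<beta> x)) \<le> (C * exp (M * T) ^ p * D) * norm x ^ (p + l)"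
      by (simp add: power_mult_distrib power_add mult_ac)
    moreover have "local_flow W F x (\<alpha> x) = \<Gamma> x (\<alpha> x)" "local_flow W F x (\<beta> x) = \<Gamma> x (\<beta> x)"
      using elim(3) t by (auto intro!: local_flow_eq)
    ultimately show ?case by (simp add: shift_def)
  qed
  then show ?thesis unfolding vanishes_to_def by blast
qed

text \<open>Times add up along a trajectory, but the second time is evaluated at the point already reached.\<close>

lemma shift_shift:
  assumes \<alpha>: "vanishes_to 0 \<alpha>" and \<beta>: "vanishes_to 0 \<beta>"
  shows "\<forall>\<^sub>F x in nhds 0. shift W F \<alpha> (shift W F \<beta> x) = shift W F (\<lambda>x. \<alpha> (shift W F \<beta> x) + \<beta> x) x"
proof -
  obtain A B where A: "\<forall>\<^sub>F x in nhds 0. norm (\<alpha> x) \<le> A * norm x ^ 0"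
    and B: "\<forall>\<^sub>F x in nhds 0. norm (\<beta> x) \<le> B * norm x ^ 0"
    using \<alpha> \<beta> unfolding vanishes_to_def by blast
  have lim: "filterlim (shift W F \<beta>) (nhds 0) (nhds 0)"
    by (rule vanishes_to_imp_filterlim[OF shift_vanishes_to[OF \<beta>]])
  have 1: "\<forall>\<^sub>F x in nhds 0. norm (\<alpha> (shift W F \<beta> x)) \<le> A * norm (shift W F \<beta> x) ^ 0"
    using A lim by (rule eventually_compose_filterlim)
  have 2: "\<forall>\<^sub>F x in nhds 0. \<forall>t. \<bar>t\<bar> \<le> A \<longrightarrow> norm (shift W F \<beta> x) * exp (M * \<bar>t\<bar>) \<le> r"
    using eventually_small[OF radius_pos] lim by (rule eventually_compose_filterlim)
  \<comment> \<open>the total time is at most \<open>A + B\<close>; the absolute value makes it at least \<open>B\<close> even if \<open>A < 0\<close>\<close>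
  have 3: "\<forall>\<^sub>F x in nhds (0::'a). \<forall>t. \<bar>t\<bar> \<le> \<bar>A\<bar> + B \<longrightarrow> norm x * exp (M * \<bar>t\<bar>) \<le> r"
    by (rule eventually_small[OF radius_pos])
  from 1 2 3 B show ?thesis
  proof eventually_elim
    case (elim x)
    define y where "y = shift W F \<beta> x"
    have b: "\<bar>\<beta> x\<bar> \<le> B" using elim(4) by simp
    have a: "\<bar>\<alpha> y\<bar> \<le> A" using elim(1) by (simp add: y_def)
    have "norm x * exp (M * \<bar>\<beta> x\<bar>) \<le> r" using elim(3) b by auto
    then have y: "y = \<Gamma> x (\<beta> x)" by (simp add: y_def shift_def local_flow_eq)
    have "norm x * exp (M * \<bar>\<alpha> y + \<beta> x\<bar>) \<le> r" using elim(3) a b by auto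
    then have "local_flow W F x (\<alpha> y + \<beta> x) = \<Gamma> x (\<alpha> y + \<beta> x)" by (rule local_flow_eq)
    moreover have "norm y * exp (M * \<bar>\<alpha> y\<bar>) \<le> r" using elim(2) a by (simp add: y_def)
    then have "local_flow W F y (\<alpha> y) = \<Gamma> y (\<alpha> y)" by (rule local_flow_eq)
    moreover have "\<Gamma> y (\<alpha> y) = \<Gamma> x (\<alpha> y + \<beta> x)"
      unfolding y flow_add by (simp add: add.commute)
    ultimately show ?case by (simp add: shift_def y_def[unfolded shift_def, symmetric])
  qed
qed

end

section \<open>Smoothness of series of functions\<close>

lemma has_derivative_frechet:
  "f differentiable (at x) \<Longrightarrow> (f has_derivative frechet_derivative f (at x)) (at x)"
  by (simp add: frechet_derivative_works)

lemma Ck_on_SucD: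
  assumes "Ck_on (Suc k) UNIV f"
  shows "f differentiable (at x)" "Ck_on k UNIV (dderiv v f)"
  using assms by simp_all

lemma Ck_on_SucI:
  assumes "\<And>x. f differentiable (at x)" "\<And>v. Ck_on k UNIV (dderiv v f)"
  shows "Ck_on (Suc k) UNIV f"
  using assms by simp

lemma Ck_on_scaleR: "Ck_on k UNIV f \<Longrightarrow> Ck_on k UNIV (\<lambda>x. c *\<^sub>R f x)"
proof (induction k arbitrary: f)
  case 0
  then show ?case by (simp add: continuous_on_scaleR)
next
  case (Suc k)
  have der: "((\<lambda>x. c *\<^sub>R f x) has_derivative (\<lambda>v. c *\<^sub>R frechet_derivative f (at x) v)) (at x)" for x
    by (intro has_derivative_scaleR_right has_derivative_frechet Ck_on_SucD(1)[OF Suc.prems])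
  show ?case
  proof (rule Ck_on_SucI)
    show "Ck_on k UNIV (dderiv v (\<lambda>x. c *\<^sub>R f x))" for v
      unfolding frechet_derivative_at[OF der, symmetric] by (rule Suc.IH[OF Ck_on_SucD(2)[OF Suc.prems]])
  qed (use der in \<open>unfold differentiable_def, blast\<close>)
qed

lemma Ck_on_add: "Ck_on k UNIV f \<Longrightarrow> Ck_on k UNIV g \<Longrightarrow> Ck_on k UNIV (\<lambda>x. f x + g x)"
proof (induction k arbitrary: f g)
  case 0
  then show ?case by (simp add: continuous_on_add)
next
  case (Suc k)
  have der: "((\<lambda>x. f x + g x) has_derivative
      (\<lambda>v. frechet_derivative f (at x) v + frechet_derivative g (at x) v)) (at x)" for x
    by (intro has_derivative_add has_derivative_frechet Ck_on_SucD(1)[OF Suc.prems(1)]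
        Ck_on_SucD(1)[OF Suc.prems(2)])
  show ?case
  proof (rule Ck_on_SucI)
    show "Ck_on k UNIV (dderiv v (\<lambda>x. f x + g x))" for v
      unfolding frechet_derivative_at[OF der, symmetric]
      by (rule Suc.IH[OF Ck_on_SucD(2)[OF Suc.prems(1)] Ck_on_SucD(2)[OF Suc.prems(2)]])
  qed (use der in \<open>unfold differentiable_def, blast\<close>)
qed

lemma Ck_on_zero: "Ck_on k UNIV (\<lambda>x. 0)"
  by (induction k) (auto simp: frechet_derivative_const)

lemma Ck_on_sum:
  assumes "\<And>i. i \<in> I \<Longrightarrow> Ck_on k UNIV (f i)"
  shows "Ck_on k UNIV (\<lambda>x. \<Sum>i\<in>I. f i x)"
proof (cases "finite I")
  case True
  then show ?thesis using assms
  proof (induction I)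
    case (insert i I)
    have "Ck_on k UNIV (\<lambda>x. f i x + (\<Sum>i\<in>I. f i x))"
      by (intro Ck_on_add insert) auto
    then show ?case using insert.hyps by simp
  qed (simp add: Ck_on_zero)
qed (simp add: Ck_on_zero)

lemma Ck_on_Suc_basis:
  fixes f :: "'a::euclidean_space \<Rightarrow> 'b::real_normed_vector"
  assumes diff: "\<And>x. f differentiable (at x)" and "\<And>b. b \<in> Basis \<Longrightarrow> Ck_on k UNIV (dderiv b f)"
  shows "Ck_on (Suc k) UNIV f"
proof (rule Ck_on_SucI[OF diff])
  fix v
  have "Ck_on k UNIV (\<lambda>x. \<Sum>b\<in>Basis. (v \<bullet> b) *\<^sub>R frechet_derivative f (at x) b)"
    by (intro Ck_on_sum Ck_on_scaleR assms(2))
  then show "Ck_on k UNIV (dderiv v f)"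
    by (simp only: dderiv_basis[OF diff, symmetric])
qed

text \<open>Differentiation under the sum. The term \<open>fold dderiv w f\<close> is the mixed partial derivative of \<open>f\<close> along
  the word \<open>w\<close>. Bounds for words of basis vectors suffice, since the derivative in an arbitrary direction is
  a combination of partial derivatives.\<close>

lemma Ck_on_suminf:
  fixes f :: "nat \<Rightarrow> 'a::euclidean_space \<Rightarrow> 'b::banach"
  assumes M: "summable M" and "\<And>j. smooth_on UNIV (f j)"
    and "\<And>w j x. set w \<subseteq> Basis \<Longrightarrow> length w \<le> k \<Longrightarrow> norm (fold dderiv w (f j) x) \<le> M j"
  shows "Ck_on k UNIV (\<lambda>x. \<Sum>j. f j x)"
  using assms(2,3)
proof (induction k arbitrary: f)
  case 0
  have "uniform_limit UNIV (\<lambda>n x. \<Sum>j<n. f j x) (\<lambda>x. \<Sum>j. f j x) sequentially"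
    using 0(2)[of "[]"] by (intro Weierstrass_m_test[OF _ M]) auto
  moreover have "continuous_on UNIV (\<lambda>x. \<Sum>j<n. f j x)" for n
    by (intro continuous_on_sum smooth_on_continuous 0)
  ultimately have "continuous_on UNIV (\<lambda>x. \<Sum>j. f j x)"
    by (intro uniform_limit_theorem[OF always_eventually]) auto
  then show ?case by simp
next
  case (Suc k)
  have bound: "norm (fold dderiv w (dderiv b (f j)) x) \<le> M j"
    if "b \<in> Basis" "set w \<subseteq> Basis" "length w \<le> k" for b w j x
    using Suc.prems(2)[of "b # w" j x] that by simp
  have ul: "uniform_limit UNIV (\<lambda>n x. \<Sum>j<n. dderiv b (f j) x) (\<lambda>x. \<Sum>j. dderiv b (f j) x) sequentially"
    if "b \<in> Basis" for b
    using bound[OF that, of "[]"] by (intro Weierstrass_m_test[OF _ M]) auto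
  define f' where "f' j x h = (\<Sum>b\<in>Basis. (h \<bullet> b) *\<^sub>R frechet_derivative (f j) (at x) b)" for j x h
  define g' where "g' x h = (\<Sum>b\<in>Basis. (h \<bullet> b) *\<^sub>R (\<Sum>j. frechet_derivative (f j) (at x) b))" for x h
  have diff: "f j differentiable (at x)" for j x
    by (rule smooth_on_differentiable[OF Suc.prems(1)]) simp
  have "\<exists>g. \<forall>x\<in>UNIV. (\<lambda>n. f n x) sums g x \<and> (g has_derivative g' x) (at x within UNIV)"
  proof (rule has_derivative_series)
    show "(f n has_derivative f' n x) (at x within UNIV)" for n x
      using has_derivative_frechet[OF diff[of n x]]
      by (simp add: f'_def[abs_def] dderiv_basis[OF diff, symmetric])
    show "(\<lambda>n. f n 0) sums (\<Sum>n. f n 0)"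
      using Suc.prems(2)[of "[]" _ 0] by (intro summable_sums summable_comparison_test'[OF M]) auto
    fix e :: real assume "e > 0"
    define d where "d = e / DIM('a)"
    have "d > 0" using \<open>e > 0\<close> by (simp add: d_def)
    then have "\<forall>\<^sub>F n in sequentially. \<forall>x\<in>UNIV. dist (\<Sum>j<n. dderiv b (f j) x) (\<Sum>j. dderiv b (f j) x) < d"
      if "b \<in> Basis" for b
      using uniform_limitD[OF ul[OF that]] by blast
    then have "\<forall>\<^sub>F n in sequentially. \<forall>b\<in>Basis. \<forall>x\<in>UNIV.
        dist (\<Sum>j<n. dderiv b (f j) x) (\<Sum>j. dderiv b (f j) x) < d"
      by (intro eventually_ball_finite) auto
    then show "\<forall>\<^sub>F n in sequentially. \<forall>x\<in>UNIV. \<forall>h. norm ((\<Sum>i<n. f' i x h) - g' x h) \<le> e * norm h"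
    proof eventually_elim
      case (elim n)
      show ?case
      proof (intro ballI allI)
        fix x h :: 'a
        have "(\<Sum>i<n. f' i x h) = (\<Sum>b\<in>Basis. (h \<bullet> b) *\<^sub>R (\<Sum>i<n. dderiv b (f i) x))"
          unfolding f'_def by (subst sum.swap) (simp add: scaleR_sum_right)
        then have "(\<Sum>i<n. f' i x h) - g' x h
            = (\<Sum>b\<in>Basis. (h \<bullet> b) *\<^sub>R ((\<Sum>i<n. dderiv b (f i) x) - (\<Sum>i. dderiv b (f i) x)))"
          by (simp add: g'_def sum_subtractf scaleR_diff_right)
        also have "norm \<dots> \<le> (\<Sum>b\<in>(Basis::'a set). norm h * d)"
        proof (rule sum_norm_le)
          fix b :: 'a assume b: "b \<in> Basis"
          have "norm ((\<Sum>i<n. dderiv b (f i) x) - (\<Sum>i. dderiv b (f i) x)) \<le> d"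
            using elim b by (auto simp: dist_norm less_imp_le)
          then show "norm ((h \<bullet> b) *\<^sub>R ((\<Sum>i<n. dderiv b (f i) x) - (\<Sum>i. dderiv b (f i) x))) \<le> norm h * d"
            unfolding norm_scaleR using Basis_le_norm[OF b, of h] by (intro mult_mono) auto
        qed
        also have "\<dots> = e * norm h" by (simp add: d_def)
        finally show "norm ((\<Sum>i<n. f' i x h) - g' x h) \<le> e * norm h" .
      qed
    qed
  qed auto
  then obtain g where g: "\<And>x. (\<lambda>n. f n x) sums g x" "\<And>x. (g has_derivative g' x) (at x)"
    by auto
  then have g_eq: "(\<lambda>x. \<Sum>j. f j x) = g" by (auto simp: sums_iff)
  show ?case
    unfolding g_eq
  proof (rule Ck_on_Suc_basis)
    show "g differentiable (at x)" for x using g(2) unfolding differentiable_def by blast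
    fix b :: 'a assume b: "b \<in> Basis"
    have eq: "dderiv b g = (\<lambda>x. \<Sum>j. dderiv b (f j) x)"
      by (auto simp: frechet_derivative_at[OF g(2), symmetric] g'_def inner_Basis b if_distrib[of "\<lambda>c. c *\<^sub>R _"]
          cong: if_cong)
    show "Ck_on k UNIV (dderiv b g)"
      unfolding eq by (rule Suc.IH[OF smooth_on_dderiv[OF Suc.prems(1)] bound[OF b]])
  qed
qed

section \<open>Polynomials times a Gaussian\<close>

lemma real_polynomial_function_dderiv:
  fixes p :: "'a::real_normed_vector \<Rightarrow> real"
  assumes "real_polynomial_function p"
  shows "(\<forall>x. p differentiable (at x)) \<and> (\<forall>v. real_polynomial_function (dderiv v p))"
  using assms
proof induction
  case (linear f)
  then have der: "(f has_derivative f) (at x)" for x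
    by (rule bounded_linear_imp_has_derivative)
  show ?case
    unfolding frechet_derivative_at[OF der, symmetric] using der
    by (auto simp: differentiable_def)
next
  case (const c)
  then show ?case by (auto simp: frechet_derivative_const)
next
  case (add f g)
  have der: "((\<lambda>x. f x + g x) has_derivative
      (\<lambda>v. frechet_derivative f (at x) v + frechet_derivative g (at x) v)) (at x)" for x
    by (intro has_derivative_add has_derivative_frechet) (use add.IH in auto)
  show ?case
    unfolding frechet_derivative_at[OF der, symmetric] using der add.IH
    by (auto simp: differentiable_def)
next
  case (mult f g)
  have der: "((\<lambda>x. f x * g x) has_derivative
      (\<lambda>v. f x * frechet_derivative g (at x) v + frechet_derivative f (at x) v * g x)) (at x)" for x
    by (intro has_derivative_mult has_derivative_frechet) (use mult.IH in auto)
  show ?case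
    unfolding frechet_derivative_at[OF der, symmetric]
  proof (intro conjI allI)
    show "(\<lambda>x. f x * g x) differentiable (at x)" for x
      using der unfolding differentiable_def by blast
    show "real_polynomial_function (\<lambda>x. f x * dderiv v g x + dderiv v f x * g x)" for v
      using mult by (intro real_polynomial_function.intros(3) real_polynomial_function.intros(4)) auto
  qed
qed

abbreviation gaussian_poly :: "real \<Rightarrow> ('a::euclidean_space \<Rightarrow> real) \<Rightarrow> 'a \<Rightarrow> real"
  where "gaussian_poly c p \<equiv> (\<lambda>x. p x * exp (- (c * (x \<bullet> x))))"

text \<open>The class of products of polynomials with a fixed Gaussian is closed under differentiation. This gives
  smoothness and control of all derivatives at once.\<close>

lemma gaussian_poly_dderiv:
  assumes "real_polynomial_function p"
  shows "gaussian_poly c p differentiable (at x)"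
    and "\<exists>q. real_polynomial_function q \<and> dderiv v (gaussian_poly c p) = gaussian_poly c q"
proof -
  have der: "(gaussian_poly c p has_derivative
      (\<lambda>v. (frechet_derivative p (at x) v - 2 * c * (x \<bullet> v) * p x) * exp (- (c * (x \<bullet> x))))) (at x)" for x
    using has_derivative_frechet[of p x] real_polynomial_function_dderiv[OF assms]
    by (auto intro!: derivative_eq_intros simp: algebra_simps inner_commute)
  then show "gaussian_poly c p differentiable (at x)" unfolding differentiable_def by blast
  have "real_polynomial_function (\<lambda>x. frechet_derivative p (at x) v - 2 * c * (x \<bullet> v) * p x)"
    using real_polynomial_function_dderiv[OF assms]
      real_polynomial_function.intros(4)[OF real_polynomial_function.intros(4)[OF real_polynomial_function.intros(2)
          real_polynomial_function.intros(1)[OF bounded_linear_inner_left]] assms]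
    by (intro real_polynomial_function_diff) blast+
  then show "\<exists>q. real_polynomial_function q \<and> dderiv v (gaussian_poly c p) = gaussian_poly c q"
    unfolding frechet_derivative_at[OF der, symmetric] by blast
qed

lemma smooth_on_gaussian_poly:
  fixes p :: "'a::euclidean_space \<Rightarrow> real"
  assumes "real_polynomial_function p"
  shows "smooth_on UNIV (gaussian_poly c p)"
proof -
  have "Ck_on k UNIV (gaussian_poly c p)" for k
    using assms
  proof (induction k arbitrary: p)
    case 0
    have "continuous_on UNIV (gaussian_poly c p)"
      by (intro continuous_at_imp_continuous_on ballI differentiable_imp_continuous_within
          gaussian_poly_dderiv(1)[OF 0])
    then show ?case by simp
  next
    case (Suc k)
    show ?case
    proof (rule Ck_on_SucI[OF gaussian_poly_dderiv(1)[OF Suc.prems]])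
      fix v
      obtain q where "real_polynomial_function q" "dderiv v (gaussian_poly c p) = gaussian_poly c q"
        using gaussian_poly_dderiv(2)[OF Suc.prems] by blast
      then show "Ck_on k UNIV (dderiv v (gaussian_poly c p))"
        using Suc.IH by simp
    qed
  qed
  then show ?thesis by (simp add: smooth_on_def)
qed

lemma smooth_on_real_polynomial_function:
  "real_polynomial_function p \<Longrightarrow> smooth_on UNIV p"
  using smooth_on_gaussian_poly[of p 0] by simp

lemma gaussian_poly_fold_dderiv:
  assumes "real_polynomial_function p"
  shows "\<exists>q. real_polynomial_function q \<and> fold dderiv w (gaussian_poly c p) = gaussian_poly c q"
  using assms
proof (induction w arbitrary: p)
  case (Cons v w)
  obtain q where q: "real_polynomial_function q" "dderiv v (gaussian_poly c p) = gaussian_poly c q"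
    using gaussian_poly_dderiv(2)[OF Cons.prems] by blast
  from Cons.IH[OF q(1)] show ?case by (simp add: q(2))
qed auto

text \<open>An exponential bound is used instead of a power of \<open>1 + \<bar>x\<bar>\<close> because it is visibly stable under sums and
  products.\<close>

lemma real_polynomial_function_exp_bound:
  fixes p :: "'a::euclidean_space \<Rightarrow> real"
  assumes "real_polynomial_function p"
  shows "\<exists>C N. C \<ge> 0 \<and> N \<ge> 0 \<and> (\<forall>x. \<bar>p x\<bar> \<le> C * exp (N * norm x))"
  using assms
proof induction
  case (linear f)
  then obtain K where K: "K > 0" "\<And>x. norm (f x) \<le> norm x * K"
    using bounded_linear.pos_bounded by blast
  have "\<bar>f x\<bar> \<le> K * exp (1 * norm x)" for x
  proof -
    have "norm x \<le> exp (norm x)" using exp_ge_add_one_self[of "norm x"] by linarith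
    then have "K * norm x \<le> K * exp (norm x)" using K(1) by simp
    moreover have "\<bar>f x\<bar> \<le> K * norm x" using K(2)[of x] by (simp add: mult.commute)
    ultimately show ?thesis by simp
  qed
  then show ?case using K by (intro exI[of _ K] exI[of _ 1]) auto
next
  case (const c)
  show ?case by (intro exI[of _ "\<bar>c\<bar>"] exI[of _ 0]) auto
next
  case (add f g)
  then obtain C N D K where f: "C \<ge> 0" "N \<ge> 0" "\<And>x. \<bar>f x\<bar> \<le> C * exp (N * norm x)"
    and g: "D \<ge> 0" "K \<ge> 0" "\<And>x. \<bar>g x\<bar> \<le> D * exp (K * norm x)" by blast
  have "\<bar>f x + g x\<bar> \<le> (C + D) * exp ((N + K) * norm x)" for x
  proof -
    have "\<bar>f x + g x\<bar> \<le> C * exp (N * norm x) + D * exp (K * norm x)"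
      using f(3)[of x] g(3)[of x] by linarith
    also have "\<dots> \<le> C * exp ((N + K) * norm x) + D * exp ((N + K) * norm x)"
      using f g by (intro add_mono mult_left_mono) (auto intro: mult_right_mono)
    finally show ?thesis by (simp add: algebra_simps)
  qed
  then show ?case using f g by (intro exI[of _ "C + D"] exI[of _ "N + K"]) auto
next
  case (mult f g)
  then obtain C N D K where f: "C \<ge> 0" "N \<ge> 0" "\<And>x. \<bar>f x\<bar> \<le> C * exp (N * norm x)"
    and g: "D \<ge> 0" "K \<ge> 0" "\<And>x. \<bar>g x\<bar> \<le> D * exp (K * norm x)" by blast
  have "\<bar>f x * g x\<bar> \<le> (C * D) * exp ((N + K) * norm x)" for x
  proof -
    have "\<bar>f x * g x\<bar> \<le> (C * exp (N * norm x)) * (D * exp (K * norm x))"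
      unfolding abs_mult using f g by (intro mult_mono) auto
    then show ?thesis unfolding distrib_right exp_add by (simp only: mult_ac)
  qed
  then show ?case using f g by (intro exI[of _ "C * D"] exI[of _ "N + K"]) auto
qed

lemma gaussian_poly_bounded:
  fixes p :: "'a::euclidean_space \<Rightarrow> real"
  assumes "real_polynomial_function p"
  shows "\<exists>B. \<forall>x. \<bar>gaussian_poly 1 p x\<bar> \<le> B"
proof -
  obtain C N where C: "C \<ge> 0" "\<And>x. \<bar>p x\<bar> \<le> C * exp (N * norm x)"
    using real_polynomial_function_exp_bound[OF assms] by blast
  have "\<bar>gaussian_poly 1 p x\<bar> \<le> C * exp (N\<^sup>2 / 4)" for x
  proof -
    have "0 \<le> (norm x - N / 2)\<^sup>2" by (rule zero_le_power2)
    also have "\<dots> = N\<^sup>2 / 4 - (N * norm x - x \<bullet> x)"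
      unfolding power2_diff by (simp add: dot_square_norm power_divide mult.commute)
    finally have square: "N * norm x - x \<bullet> x \<le> N\<^sup>2 / 4" by simp
    have "\<bar>gaussian_poly 1 p x\<bar> \<le> C * exp (N * norm x) * exp (- (1 * (x \<bullet> x)))"
      unfolding abs_mult abs_exp_cancel by (intro mult_right_mono C) simp
    also have "\<dots> = C * exp (N * norm x - x \<bullet> x)" by (simp add: exp_diff exp_minus field_simps)
    also have "\<dots> \<le> C * exp (N\<^sup>2 / 4)" 
      by (intro mult_left_mono C(1)) (simp only: exp_le_cancel_iff square)
    finally show ?thesis .
  qed
  then show ?thesis by blast
qed

section \<open>Smooth functions with prescribed leading terms\<close>

lemma fold_dderiv_rescale:
  fixes g :: "'a::euclidean_space \<Rightarrow> real"
  assumes "smooth_on UNIV g"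
  shows "fold dderiv w (\<lambda>x. a * g (\<sigma> *\<^sub>R x)) = (\<lambda>x. a * \<sigma> ^ length w * fold dderiv w g (\<sigma> *\<^sub>R x))"
  using assms
proof (induction w arbitrary: a g)
  case (Cons v w)
  have der: "((\<lambda>x. a * g (\<sigma> *\<^sub>R x)) has_derivative
      (\<lambda>v. a * frechet_derivative g (at (\<sigma> *\<^sub>R x)) (\<sigma> *\<^sub>R v))) (at x)" for x
    by (intro has_derivative_mult_right
        has_derivative_compose[where g = g, OF has_derivative_scaleR_right[OF has_derivative_ident]]
        has_derivative_frechet smooth_on_differentiable[OF Cons.prems]) simp
  have "dderiv v (\<lambda>x. a * g (\<sigma> *\<^sub>R x)) = (\<lambda>x. (a * \<sigma>) * dderiv v g (\<sigma> *\<^sub>R x))"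
    unfolding frechet_derivative_at[OF der, symmetric]
    using smooth_on_differentiable[OF Cons.prems]
    by (simp add: linear_scale[OF linear_frechet_derivative] mult.assoc)
  then have "fold dderiv (v # w) (\<lambda>x. a * g (\<sigma> *\<^sub>R x)) = fold dderiv w (\<lambda>x. (a * \<sigma>) * dderiv v g (\<sigma> *\<^sub>R x))"
    by (simp only: fold_simps)
  also have "\<dots> = (\<lambda>x. (a * \<sigma>) * \<sigma> ^ length w * fold dderiv w (dderiv v g) (\<sigma> *\<^sub>R x))"
    by (rule Cons.IH[OF smooth_on_dderiv[OF Cons.prems]])
  finally show ?case by (simp add: mult_ac)
qed simp

lemma homogeneous_bound:
  fixes \<omega> :: "'a::euclidean_space \<Rightarrow> real"
  assumes cont: "continuous_on UNIV \<omega>" and hom: "\<And>t x. \<omega> (t *\<^sub>R x) = t ^ l * \<omega> x"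
  shows "\<exists>C\<ge>0. \<forall>x. \<bar>\<omega> x\<bar> \<le> C * norm x ^ l"
proof -
  have "bounded (\<omega> ` cball 0 1)"
    using compact_continuous_image[OF continuous_on_subset[OF cont] compact_cball]
    by (simp add: compact_imp_bounded)
  then obtain C where "\<forall>y\<in>\<omega> ` cball 0 1. norm y \<le> C" unfolding bounded_iff by blast
  then have C: "\<bar>\<omega> x\<bar> \<le> C" if "norm x \<le> 1" for x using that by simp
  have "\<bar>\<omega> x\<bar> \<le> C * norm x ^ l" for x
  proof -
    \<comment> \<open>any point of the unit ball would do for \<open>x = 0\<close>\<close>
    define y where "y = (if x = 0 then 0 else x /\<^sub>R norm x)"
    have "x = norm x *\<^sub>R y" by (simp add: y_def)
    then have "\<bar>\<omega> x\<bar> = norm x ^ l * \<bar>\<omega> y\<bar>" using hom[of "norm x" y] by (simp add: abs_mult)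
    also have "\<dots> \<le> norm x ^ l * C" by (intro mult_left_mono C) (auto simp: y_def)
    finally show ?thesis by (simp add: mult.commute)
  qed
  moreover have "C \<ge> 0" using order_trans[OF abs_ge_zero C[of 0]] by simp
  ultimately show ?thesis by blast
qed

text \<open>The function is \<open>f x = s\<^sup>j\<^sup>+\<^sup>1 g (x / s)\<close> with \<open>g x = \<omega> x exp (- \<bar>x\<bar>\<^sup>2)\<close>, which by homogeneity equals
  \<open>\<omega> x exp (- \<bar>x\<bar>\<^sup>2 / s\<^sup>2)\<close>. All derivatives of \<open>g\<close> are bounded, and a derivative of order \<open>k\<close> is multiplied
  by \<open>s\<^sup>j\<^sup>+\<^sup>1\<^sup>-\<^sup>k\<close>, hence by at most \<open>s\<close> when \<open>k \<le> j\<close>. Multiplication by the Gaussian changes \<open>\<omega>\<close> only in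
  degree at least \<open>j + 3\<close>.\<close>

lemma borel_term:
  fixes \<omega> :: "'a::euclidean_space \<Rightarrow> real"
  assumes poly: "real_polynomial_function \<omega>" and hom: "\<And>t x. \<omega> (t *\<^sub>R x) = t ^ Suc j * \<omega> x"
    and "\<epsilon> > 0"
  shows "\<exists>f. smooth_on UNIV f \<and>
    (\<forall>w x. set w \<subseteq> Basis \<longrightarrow> length w \<le> j \<longrightarrow> \<bar>fold dderiv w f x\<bar> \<le> \<epsilon>) \<and>
    (\<forall>x. \<bar>f x\<bar> \<le> \<epsilon> * norm x ^ j) \<and>
    vanishes_to (Suc (Suc j)) (\<lambda>x. f x - \<omega> x)"
proof -
  have smooth_\<omega>: "smooth_on UNIV \<omega>" by (rule smooth_on_real_polynomial_function[OF poly])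
  obtain C where C: "C \<ge> 0" "\<And>x. \<bar>\<omega> x\<bar> \<le> C * norm x ^ Suc j"
    using homogeneous_bound[OF smooth_on_continuous[OF smooth_\<omega>] hom] by blast
  define g where "g = gaussian_poly 1 \<omega>"
  have smooth_g: "smooth_on UNIV g" unfolding g_def by (rule smooth_on_gaussian_poly[OF poly])
  define words where "words = {w :: 'a list. set w \<subseteq> Basis \<and> length w \<le> j}"
  have fin: "finite words" unfolding words_def by (intro finite_lists_length_le finite_Basis)
  have "\<exists>B. \<forall>x. \<bar>fold dderiv w g x\<bar> \<le> B" for w
  proof -
    obtain q where q: "real_polynomial_function q" "fold dderiv w g = gaussian_poly 1 q"
      using gaussian_poly_fold_dderiv[OF poly] unfolding g_def by blast
    show ?thesis unfolding q(2) by (rule gaussian_poly_bounded[OF q(1)])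
  qed
  then obtain B' where B': "\<And>w x. \<bar>fold dderiv w g x\<bar> \<le> B' w" by metis
  define B where "B = (\<Sum>w\<in>words. B' w)"
  have B'0: "B' w \<ge> 0" for w using order_trans[OF abs_ge_zero B'[of w 0]] .
  then have B0: "B \<ge> 0" by (simp add: B_def sum_nonneg)
  have B: "\<bar>fold dderiv w g x\<bar> \<le> B" if "w \<in> words" for w x
    unfolding B_def by (rule order_trans[OF B' member_le_sum[OF that _ fin]]) (rule B'0)
  \<comment> \<open>small enough for the finitely many derivative bounds and the pointwise bound together\<close>
  define s where "s = min 1 (\<epsilon> / (B + C + 1))"
  have s: "0 < s" "s \<le> 1" using B0 C \<open>\<epsilon> > 0\<close> by (auto simp: s_def)
  have "s * (B + C + 1) \<le> \<epsilon> / (B + C + 1) * (B + C + 1)"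
    using B0 C by (intro mult_right_mono) (auto simp: s_def)
  also have "\<dots> = \<epsilon>" using B0 C by simp
  finally have "s * B + s * C + s \<le> \<epsilon>" by (simp add: algebra_simps)
  moreover have "s * B \<ge> 0" "s * C \<ge> 0" using s B0 C by auto
  ultimately have sB: "s * B \<le> \<epsilon>" and sC: "s * C \<le> \<epsilon>" using s by linarith+
  define f where "f x = s ^ Suc j * g ((1 / s) *\<^sub>R x)" for x
  have f_eq: "f = gaussian_poly ((1 / s)\<^sup>2) \<omega>"
  proof
    fix x
    have "f x = s ^ Suc j * ((1 / s) ^ Suc j * \<omega> x) * exp (- (((1 / s) *\<^sub>R x) \<bullet> ((1 / s) *\<^sub>R x)))"
      by (simp only: f_def g_def hom mult_1 mult.assoc)
    also have "s ^ Suc j * ((1 / s) ^ Suc j * \<omega> x) = \<omega> x"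
      using s by (simp add: power_one_over)
    finally show "f x = gaussian_poly ((1 / s)\<^sup>2) \<omega> x" by (simp add: power2_eq_square)
  qed
  have "smooth_on UNIV f" unfolding f_eq by (rule smooth_on_gaussian_poly[OF poly])
  moreover have "\<bar>fold dderiv w f x\<bar> \<le> \<epsilon>" if w: "set w \<subseteq> Basis" "length w \<le> j" for w x
  proof -
    have "\<bar>fold dderiv w f x\<bar> = s ^ Suc j * (1 / s) ^ length w * \<bar>fold dderiv w g ((1 / s) *\<^sub>R x)\<bar>"
      unfolding f_def fold_dderiv_rescale[OF smooth_g] using s by (simp add: abs_mult)
    also have "s ^ Suc j * (1 / s) ^ length w = s * s ^ (j - length w)"
      using s w by (simp add: power_diff field_simps)
    also have "\<dots> * \<bar>fold dderiv w g ((1 / s) *\<^sub>R x)\<bar> \<le> (s * 1) * B"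
      using s w by (intro mult_mono B) (auto simp: words_def power_le_one)
    finally show ?thesis using sB by simp
  qed
  moreover have "\<bar>f x\<bar> \<le> \<epsilon> * norm x ^ j" for x
  proof -
    define y where "y = (1 / s) *\<^sub>R x"
    have "norm y \<le> 1 + (norm y)\<^sup>2"
    proof (cases "norm y \<le> 1")
      case False
      then have "norm y * 1 \<le> norm y * norm y" by (intro mult_left_mono) auto
      then show ?thesis by (simp add: power2_eq_square)
    qed (simp add: add_increasing2)
    also have "\<dots> \<le> exp (y \<bullet> y)" unfolding dot_square_norm by (rule exp_ge_add_one_self)
    finally have gauss: "norm y * exp (- (y \<bullet> y)) \<le> 1" by (simp add: exp_minus field_simps)
    have "\<bar>f x\<bar> = s ^ Suc j * (\<bar>\<omega> y\<bar> * exp (- (y \<bullet> y)))"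
      using s by (simp add: f_def g_def y_def abs_mult)
    also have "\<dots> \<le> s ^ Suc j * ((C * norm y ^ Suc j) * exp (- (y \<bullet> y)))"
      using s by (intro mult_left_mono mult_right_mono C) auto
    also have "\<dots> = s ^ Suc j * (C * norm y ^ j) * (norm y * exp (- (y \<bullet> y)))" by simp
    also have "\<dots> \<le> s ^ Suc j * (C * norm y ^ j) * 1"
      using s C gauss by (intro mult_left_mono) auto
    also have "\<dots> = (s * C) * norm x ^ j"
      using s by (simp add: y_def power_divide)
    also have "\<dots> \<le> \<epsilon> * norm x ^ j" by (intro mult_right_mono sC) simp
    finally show ?thesis .
  qed
  moreover have "vanishes_to (Suc (Suc j)) (\<lambda>x. f x - \<omega> x)"
  proof (rule vanishes_toI[of 1])
    fix x :: 'a assume x: "norm x \<le> 1"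
    define u where "u = (1 / s)\<^sup>2 * (x \<bullet> x)"
    have u: "0 \<le> u" "u \<le> (1 / s)\<^sup>2 * norm x"
    proof -
      have "x \<bullet> x \<le> norm x" using x mult_left_le[of "norm x" "norm x"] by (simp add: dot_square_norm power2_eq_square)
      then show "u \<le> (1 / s)\<^sup>2 * norm x" unfolding u_def by (intro mult_left_mono) auto
    qed (simp add: u_def)
    have "1 - exp (- u) \<le> u" using exp_ge_add_one_self[of "- u"] by simp
    moreover have "exp (- u) \<le> 1" using u by simp
    ultimately have e: "\<bar>exp (- u) - 1\<bar> \<le> (1 / s)\<^sup>2 * norm x" using u by linarith
    have "norm (f x - \<omega> x) = \<bar>\<omega> x\<bar> * \<bar>exp (- u) - 1\<bar>"
      unfolding f_eq u_def abs_mult[symmetric] by (simp add: algebra_simps)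
    also have "\<dots> \<le> (C * norm x ^ Suc j) * ((1 / s)\<^sup>2 * norm x)"
      using C by (intro mult_mono e) auto
    finally show "norm (f x - \<omega> x) \<le> (C * (1 / s)\<^sup>2) * norm x ^ Suc (Suc j)"
      by (simp add: mult_ac)
  qed simp
  ultimately show ?thesis by blast
qed

text \<open>For \<open>C\<^sup>k\<close>-smoothness the first \<open>k\<close> terms are split off; every derivative of order at most \<open>k\<close> of the
  remaining ones is dominated by a geometric series. The same splitting shows that the sum differs
  from its \<open>k\<close>-th partial sum by \<open>O(\<bar>x\<bar>\<^sup>k)\<close>.\<close>

lemma borel_sum:
  fixes f :: "nat \<Rightarrow> 'a::euclidean_space \<Rightarrow> real"
  assumes smooth: "\<And>j. smooth_on UNIV (f j)" and smooth_a: "smooth_on UNIV a"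
    and small: "\<And>j w x. set w \<subseteq> Basis \<Longrightarrow> length w \<le> j \<Longrightarrow> \<bar>fold dderiv w (f j) x\<bar> \<le> (1 / 2) ^ j"
    and flat: "\<And>j x. \<bar>f j x\<bar> \<le> (1 / 2) ^ j * norm x ^ j"
  shows "\<exists>\<alpha>. smooth_on UNIV \<alpha> \<and> (\<forall>k. vanishes_to k (\<lambda>x. \<alpha> x - (a x + (\<Sum>j<k. f j x))))"
proof -
  have sm: "summable (\<lambda>j. (1 / 2 :: real) ^ j)" by (rule summable_geometric) simp
  have summ: "summable (\<lambda>j. f j x)" for x
    using small[of "[]" _ x] by (intro summable_comparison_test'[OF sm]) auto
  define \<alpha> where "\<alpha> x = a x + (\<Sum>j. f j x)" for x
  have tail: "\<alpha> x - (a x + (\<Sum>j<k. f j x)) = (\<Sum>j. f (j + k) x)" for x k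
    using suminf_split_initial_segment[OF summ, of x k] by (simp add: \<alpha>_def)
  have sm': "summable (\<lambda>j. (1 / 2 :: real) ^ (j + k))" for k
    using sm by (rule summable_ignore_initial_segment)
  have "smooth_on UNIV \<alpha>"
    unfolding smooth_on_def
  proof
    fix k
    have ck: "Ck_on k UNIV (f j)" "Ck_on k UNIV a" for j
      using smooth smooth_a by (simp_all add: smooth_on_def)
    have "Ck_on k UNIV (\<lambda>x. \<Sum>j. f (j + k) x)"
      using small by (intro Ck_on_suminf[OF sm'[of k] smooth]) auto
    then have "Ck_on k UNIV (\<lambda>x. (a x + (\<Sum>j<k. f j x)) + (\<Sum>j. f (j + k) x))"
      by (intro Ck_on_add Ck_on_sum ck)
    then show "Ck_on k UNIV \<alpha>" by (simp add: tail[symmetric])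
  qed
  moreover have "vanishes_to k (\<lambda>x. \<alpha> x - (a x + (\<Sum>j<k. f j x)))" for k
    unfolding tail
  proof (rule vanishes_toI[of 1])
    fix x :: 'a assume x: "norm x \<le> 1"
    have le: "norm (f (j + k) x) \<le> (1 / 2) ^ (j + k) * norm x ^ k" for j
    proof -
      have "norm (f (j + k) x) \<le> (1 / 2) ^ (j + k) * norm x ^ (j + k)"
        using flat[of "j + k" x] by simp
      also have "\<dots> \<le> (1 / 2) ^ (j + k) * norm x ^ k"
        using x by (intro mult_left_mono power_decreasing) auto
      finally show ?thesis .
    qed
    have "summable (\<lambda>j. norm (f (j + k) x))"
      by (rule summable_comparison_test'[OF summable_mult2[OF sm'[of k]]]) (use le in \<open>simp only: real_norm_def abs_idempotent\<close>)
    then have "norm (\<Sum>j. f (j + k) x) \<le> (\<Sum>j. norm (f (j + k) x))" by (rule summable_norm)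
    also have "\<dots> \<le> (\<Sum>j. (1 / 2) ^ (j + k) * norm x ^ k)"
      by (intro suminf_le le summable_mult2 sm') fact
    also have "\<dots> = (\<Sum>j. (1 / 2) ^ (j + k)) * norm x ^ k"
      by (rule suminf_mult2[OF sm', symmetric])
    finally show "norm (\<Sum>j. f (j + k) x) \<le> (\<Sum>j. (1 / 2) ^ (j + k)) * norm x ^ k" .
  qed simp
  ultimately show ?thesis by blast
qed

section \<open>One step of the approximation by shifts\<close>

lemma homogeneous_poly_real_polynomial_function:
  assumes "homogeneous_poly l \<omega>"
  shows "real_polynomial_function \<omega>"
proof -
  obtain c where c: "\<And>x. \<omega> x = (\<Sum>\<alpha> | (\<Sum>i\<in>UNIV. \<alpha> i) = l. c \<alpha> * (\<Prod>i\<in>UNIV. (x $ i) ^ \<alpha> i))"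
    using assms unfolding homogeneous_poly_def by blast
  have "real_polynomial_function (\<lambda>x. \<Sum>\<alpha>\<in>A. c \<alpha> * (\<Prod>i\<in>UNIV. (x $ i) ^ \<alpha> i))" for A :: "('a \<Rightarrow> nat) set"
  proof (cases "finite A")
    case True
    show ?thesis
      by (intro real_polynomial_function_sum[OF True] real_polynomial_function.intros(4)
          real_polynomial_function.intros(2) real_polynomial_function_prod
          real_polynomial_function_power real_polynomial_function.intros(1) bounded_linear_vec_nth) simp
  qed (simp add: real_polynomial_function.intros(2))
  then show ?thesis using c by presburger
qed

lemma homogeneous_poly_scaleR:
  assumes "homogeneous_poly l \<omega>"
  shows "\<omega> (t *\<^sub>R x) = t ^ l * \<omega> x"
proof -
  obtain c where c: "\<And>x. \<omega> x = (\<Sum>\<alpha> | (\<Sum>i\<in>UNIV. \<alpha> i) = l. c \<alpha> * (\<Prod>i\<in>UNIV. (x $ i) ^ \<alpha> i))"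
    using assms unfolding homogeneous_poly_def by blast
  show ?thesis
    unfolding c sum_distrib_left
  proof (rule sum.cong[OF refl])
    fix \<alpha> :: "'a \<Rightarrow> nat" assume "\<alpha> \<in> {\<alpha>. (\<Sum>i\<in>UNIV. \<alpha> i) = l}"
    then have "(\<Prod>i\<in>UNIV. t ^ \<alpha> i) = t ^ l" by (simp add: power_sum[symmetric])
    then show "c \<alpha> * (\<Prod>i\<in>UNIV. ((t *\<^sub>R x) $ i) ^ \<alpha> i) = t ^ l * (c \<alpha> * (\<Prod>i\<in>UNIV. (x $ i) ^ \<alpha> i))"
      by (simp add: power_mult_distrib prod.distrib)
  qed
qed

text \<open>A homogeneous function of degree \<open>j + 1\<close> has Lipschitz constant \<open>C \<rho>\<^sup>j\<close> on the ball of radius \<open>\<rho>\<close>, by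
  scaling from the unit ball; here \<open>\<rho>\<close> is a multiple of \<open>\<bar>x\<bar>\<close>.\<close>

lemma homogeneous_diff_vanishes_to:
  fixes \<omega> :: "'b::euclidean_space \<Rightarrow> real" and u v :: "'a::real_normed_vector \<Rightarrow> 'b"
  assumes smooth: "smooth_on UNIV \<omega>" and hom: "\<And>t x. \<omega> (t *\<^sub>R x) = t ^ Suc j * \<omega> x"
    and u: "vanishes_to 1 u" and v: "vanishes_to 1 v" and uv: "vanishes_to m (\<lambda>x. u x - v x)"
  shows "vanishes_to (j + m) (\<lambda>x. \<omega> (u x) - \<omega> (v x))"
proof -
  obtain C where C: "C \<ge> 0"
    and lip: "\<And>y z. y \<in> cball 0 1 \<Longrightarrow> z \<in> cball 0 1 \<Longrightarrow> norm (\<omega> y - \<omega> z) \<le> C * norm (y - z)"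
    using smooth_on_lipschitz[OF open_UNIV compact_cball convex_cball subset_UNIV smooth] by blast
  have scaled: "\<bar>\<omega> y - \<omega> z\<bar> \<le> C * \<rho> ^ j * norm (y - z)"
    if "norm y \<le> \<rho>" "norm z \<le> \<rho>" for y z \<rho>
  proof (cases "\<rho> = 0")
    case True
    then have "y = z" using that by simp
    then show ?thesis using C that(1) norm_ge_zero[of y] by simp
  next
    case False
    then have \<rho>: "\<rho> > 0" using that(1) norm_ge_zero[of y] by linarith
    have "\<omega> y - \<omega> z = \<rho> ^ Suc j * (\<omega> ((1 / \<rho>) *\<^sub>R y) - \<omega> ((1 / \<rho>) *\<^sub>R z))"
      using hom[of \<rho> "(1 / \<rho>) *\<^sub>R y"] hom[of \<rho> "(1 / \<rho>) *\<^sub>R z"] \<rho> by (simp add: right_diff_distrib)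
    then have "\<bar>\<omega> y - \<omega> z\<bar> = \<rho> ^ Suc j * norm (\<omega> ((1 / \<rho>) *\<^sub>R y) - \<omega> ((1 / \<rho>) *\<^sub>R z))"
      using \<rho> by (simp add: abs_mult)
    also have "\<dots> \<le> \<rho> ^ Suc j * (C * norm ((1 / \<rho>) *\<^sub>R y - (1 / \<rho>) *\<^sub>R z))"
      using \<rho> that by (intro mult_left_mono lip) auto
    also have "\<dots> = C * \<rho> ^ j * norm (y - z)"
      using \<rho> unfolding scaleR_diff_right[symmetric] norm_scaleR by simp
    finally show ?thesis .
  qed
  obtain A B D where A: "\<forall>\<^sub>F x in nhds 0. norm (u x) \<le> A * norm x ^ 1"
    and B: "\<forall>\<^sub>F x in nhds 0. norm (v x) \<le> B * norm x ^ 1"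
    and D: "\<forall>\<^sub>F x in nhds 0. norm (u x - v x) \<le> D * norm x ^ m"
    using u v uv unfolding vanishes_to_def by blast
  define E where "E = \<bar>A\<bar> + \<bar>B\<bar>"
  from A B D have "\<forall>\<^sub>F x in nhds 0. norm (\<omega> (u x) - \<omega> (v x)) \<le> (C * E ^ j * D) * norm x ^ (j + m)"
  proof eventually_elim
    case (elim x)
    have "A * norm x \<le> E * norm x" "B * norm x \<le> E * norm x"
      by (intro mult_right_mono; simp add: E_def)+
    then have "\<bar>\<omega> (u x) - \<omega> (v x)\<bar> \<le> C * (E * norm x) ^ j * norm (u x - v x)"
      using elim by (intro scaled) auto
    also have "\<dots> \<le> C * (E * norm x) ^ j * (D * norm x ^ m)"
      using C elim(3) by (intro mult_left_mono) (auto simp: E_def)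
    finally show ?case by (simp add: power_mult_distrib power_add mult_ac)
  qed
  then show ?thesis unfolding vanishes_to_def by blast
qed

context flow_near_zero
begin

text \<open>Here \<open>f\<close> is a smooth representative of the shift by \<open>\<alpha>\<close> and \<open>h' = h \<circ> f\<^sup>-\<^sup>1\<close> is approximated by the
  shift by \<open>\<omega>\<close>. The exact new time would be \<open>\<alpha> + \<omega> \<circ> f\<close>. Its second summand is replaced by a function \<open>\<phi>\<close>
  from \<open>borel_term\<close>, whose leading part is that of \<open>\<omega> \<circ> f\<close>, namely \<open>\<omega> \<circ> A\<close> for the derivative \<open>A\<close>
  of \<open>f\<close> at the origin.\<close>

lemma approximation_step:
  assumes F: "vanishes_to p F" and \<alpha>: "smooth_near0 \<alpha>"
    and f: "smooth_near0 f" "f 0 = 0" "\<forall>\<^sub>F x in nhds 0. f x = shift W F \<alpha> x"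
    and h: "\<forall>\<^sub>F x in nhds 0. h x = h' (f x)"
    and \<omega>: "real_polynomial_function \<omega>" "\<And>t x. \<omega> (t *\<^sub>R x) = t ^ Suc j * \<omega> x"
    and h': "vanishes_to (p + Suc (Suc j)) (\<lambda>x. h' x - shift W F \<omega> x)"
    and "\<epsilon> > 0"
  shows "\<exists>\<phi>. smooth_on UNIV \<phi> \<and>
    (\<forall>w x. set w \<subseteq> Basis \<longrightarrow> length w \<le> j \<longrightarrow> \<bar>fold dderiv w \<phi> x\<bar> \<le> \<epsilon>) \<and>
    (\<forall>x. \<bar>\<phi> x\<bar> \<le> \<epsilon> * norm x ^ j) \<and>
    vanishes_to (p + Suc (Suc j)) (\<lambda>x. h x - shift W F (\<lambda>x. \<alpha> x + \<phi> x) x)"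
proof -
  define A where "A = frechet_derivative f (at 0)"
  have f_diff: "f differentiable (at 0)"
    using f(1) smooth_on_differentiable unfolding smooth_near0_def by blast
  then have A: "bounded_linear A"
    unfolding A_def by (metis frechet_derivative_works has_derivative_bounded_linear)
  have f1: "vanishes_to 1 f" by (rule smooth_near0_vanishes_to_1[OF f(1,2)])
  have smooth_\<omega>: "smooth_on UNIV \<omega>" by (rule smooth_on_real_polynomial_function[OF \<omega>(1)])
  have cont0: "vanishes_to 0 \<alpha>" "vanishes_to 0 \<omega>"
    using \<alpha> smooth_on_UNIV_near0[OF smooth_\<omega>] by (auto intro: vanishes_to_0_isCont smooth_near0_isCont)
  have "real_polynomial_function (\<omega> \<circ> A)"
    by (rule real_polynomial_function_compose[OF polynomial_function_bounded_linear[OF A] \<omega>(1)])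
  moreover have "(\<omega> \<circ> A) (t *\<^sub>R x) = t ^ Suc j * (\<omega> \<circ> A) x" for t x
    using bounded_linear.linear[OF A] by (simp add: linear_scale \<omega>(2))
  ultimately obtain \<phi> where \<phi>: "smooth_on UNIV \<phi>"
      "\<forall>w x. set w \<subseteq> Basis \<longrightarrow> length w \<le> j \<longrightarrow> \<bar>fold dderiv w \<phi> x\<bar> \<le> \<epsilon>"
      "\<forall>x. \<bar>\<phi> x\<bar> \<le> \<epsilon> * norm x ^ j"
    and \<phi>_close: "vanishes_to (Suc (Suc j)) (\<lambda>x. \<phi> x - (\<omega> \<circ> A) x)"
    using borel_term[of "\<omega> \<circ> A" j \<epsilon>] \<open>\<epsilon> > 0\<close> by blast
  \<comment> \<open>the time whose shift is exactly the composition of the two shifts near the origin\<close>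
  define \<beta> where "\<beta> x = \<omega> (shift W F \<alpha> x) + \<alpha> x" for x
  have "vanishes_to 2 (\<lambda>x. f x - A x)"
    using jet_remainder[OF f(1), of 1] f(2)
    by (simp add: jet_def taylor_term_def A_def numeral_2_eq_2)
  then have "vanishes_to 2 (\<lambda>x. A x - f x)" by (rule vanishes_to_sym)
  moreover have "vanishes_to 1 A"
  proof -
    obtain K where "\<And>x. norm (A x) \<le> norm x * K" using bounded_linear.bounded[OF A] by blast
    then show ?thesis by (intro vanishes_toI[of 1]) (auto simp: mult.commute)
  qed
  ultimately have "vanishes_to (j + 2) (\<lambda>x. \<omega> (A x) - \<omega> (f x))"
    by (intro homogeneous_diff_vanishes_to[OF smooth_\<omega> \<omega>(2)] f1)
  then have \<omega>_close: "vanishes_to (Suc (Suc j)) (\<lambda>x. (\<omega> \<circ> A) x - \<omega> (f x))" by simp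
  have "vanishes_to (Suc (Suc j)) (\<lambda>x. \<phi> x - \<omega> (f x))"
    by (rule vanishes_to_trans[OF \<phi>_close \<omega>_close])
  moreover have "\<forall>\<^sub>F x in nhds 0. \<phi> x - \<omega> (f x) = (\<alpha> x + \<phi> x) - \<beta> x"
    using f(3) by eventually_elim (simp add: \<beta>_def)
  ultimately have diff: "vanishes_to (Suc (Suc j)) (\<lambda>x. (\<alpha> x + \<phi> x) - \<beta> x)"
    by (rule vanishes_to_transfer[rotated])
  have "vanishes_to 0 (\<lambda>x. \<alpha> x + \<phi> x)"
    using cont0(1) smooth_on_UNIV_near0[OF \<phi>(1)]
    by (intro vanishes_to_add) (auto intro: vanishes_to_0_isCont smooth_near0_isCont)
  moreover have "vanishes_to 0 \<beta>"
    unfolding \<beta>_def[abs_def]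
    by (intro vanishes_to_add vanishes_to_compose[OF cont0(2)] shift_vanishes_to cont0(1))
  ultimately have 1: "vanishes_to (p + Suc (Suc j)) (\<lambda>x. shift W F (\<lambda>x. \<alpha> x + \<phi> x) x - shift W F \<beta> x)"
    by (intro shift_diff_vanishes_to F diff)
  have "vanishes_to (p + Suc (Suc j)) (\<lambda>x. h' (f x) - shift W F \<omega> (f x))"
    using vanishes_to_compose[OF h' f1] .
  moreover have "\<forall>\<^sub>F x in nhds 0. h' (f x) - shift W F \<omega> (f x) = h x - shift W F \<beta> x"
    using h f(3) shift_shift[OF cont0(2) cont0(1)]
    by eventually_elim (simp add: \<beta>_def[abs_def])
  ultimately have "vanishes_to (p + Suc (Suc j)) (\<lambda>x. h x - shift W F \<beta> x)"
    by (rule vanishes_to_transfer[rotated])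
  from vanishes_to_trans[OF this vanishes_to_sym[OF 1]] \<phi> show ?thesis by blast
qed

end

section \<open>The group of germs of diffeomorphisms\<close>

lemma local_diffeo_smooth_near0: "local_diffeo f \<Longrightarrow> smooth_near0 f"
  unfolding local_diffeo_def smooth_near0_def by blast

lemma local_diffeo_inverse:
  assumes "local_diffeo f"
  shows "\<exists>g. local_diffeo g \<and> (\<forall>\<^sub>F x in nhds 0. g (f x) = x) \<and> (\<forall>\<^sub>F x in nhds 0. f (g x) = x)"
proof -
  obtain U V g where f0: "f 0 = 0" and U: "open U" "0 \<in> U" and V: "open V"
    and hom: "homeomorphism U V f g" and smooth: "smooth_on U f" "smooth_on V g"
    using assms unfolding local_diffeo_def by blast
  have V0: "0 \<in> V" using homeomorphism_image1[OF hom] U(2) f0 by force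
  have g0: "g 0 = 0" using homeomorphism_apply1[OF hom U(2)] f0 by simp
  have "local_diffeo g"
    unfolding local_diffeo_def using g0 V V0 U(1) homeomorphism_symD[OF hom] smooth by blast
  moreover have "\<forall>\<^sub>F x in nhds 0. g (f x) = x"
    using U homeomorphism_apply1[OF hom] unfolding eventually_nhds by blast
  moreover have "\<forall>\<^sub>F x in nhds 0. f (g x) = x"
    using V V0 homeomorphism_apply2[OF hom] unfolding eventually_nhds by blast
  ultimately show ?thesis by blast
qed

lemma diffeo_germs_mult:
  assumes "isCont g 0" "g 0 = 0"
  shows "germ f \<otimes>\<^bsub>diffeo_germs\<^esub> germ g = germ (f \<circ> g)"
  by (simp add: diffeo_germs_def germ_comp_germ[OF assms])

lemma local_diffeo_isCont: "local_diffeo f \<Longrightarrow> isCont f 0"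
  by (rule smooth_near0_isCont[OF local_diffeo_smooth_near0])

text \<open>The inverse is determined by a definite description, so uniqueness has to be shown as well: a right
  inverse \<open>k\<close> of \<open>f\<close> agrees near the origin with \<open>g \<circ> f \<circ> k = g\<close>.\<close>

lemma diffeo_germs_inv:
  assumes f: "local_diffeo f" and g: "local_diffeo g"
    and gf: "\<forall>\<^sub>F x in nhds 0. g (f x) = x" and fg: "\<forall>\<^sub>F x in nhds 0. f (g x) = x"
  shows "inv\<^bsub>diffeo_germs\<^esub> (germ f) = germ g"
  unfolding m_inv_def
proof (rule the_equality)
  have zero: "f 0 = 0" "g 0 = 0" using f g by (simp_all add: local_diffeo_def)
  have one: "\<one>\<^bsub>diffeo_germs\<^esub> = germ id" by (simp add: diffeo_germs_def)
  have "germ g \<in> carrier diffeo_germs" using g by (auto simp: diffeo_germs_def)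
  moreover have "germ (f \<circ> g) = germ id" "germ (g \<circ> f) = germ id"
    using fg gf by (simp_all add: germ_eq_iff)
  ultimately show "germ g \<in> carrier diffeo_germs \<and> germ f \<otimes>\<^bsub>diffeo_germs\<^esub> germ g = \<one>\<^bsub>diffeo_germs\<^esub>
      \<and> germ g \<otimes>\<^bsub>diffeo_germs\<^esub> germ f = \<one>\<^bsub>diffeo_germs\<^esub>"
    using diffeo_germs_mult[of g f] diffeo_germs_mult[of f g] zero local_diffeo_isCont[OF f] local_diffeo_isCont[OF g]
    by (simp add: one)
  fix y assume y: "y \<in> carrier diffeo_germs \<and> germ f \<otimes>\<^bsub>diffeo_germs\<^esub> y = \<one>\<^bsub>diffeo_germs\<^esub>
      \<and> y \<otimes>\<^bsub>diffeo_germs\<^esub> germ f = \<one>\<^bsub>diffeo_germs\<^esub>"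
  then obtain k where k: "y = germ k" "local_diffeo k" by (auto simp: diffeo_germs_def)
  have k0: "isCont k 0" "k 0 = 0" using local_diffeo_isCont[OF k(2)] k(2) by (auto simp: local_diffeo_def)
  have "germ (f \<circ> k) = germ id" using y diffeo_germs_mult[OF k0] k(1) one by metis
  then have fk: "\<forall>\<^sub>F x in nhds 0. f (k x) = x" by (simp add: germ_eq_iff)
  have "filterlim k (nhds 0) (nhds 0)"
    using k0 by (metis isContD tendsto_at_iff_tendsto_nhds)
  with gf have "\<forall>\<^sub>F x in nhds 0. g (f (k x)) = k x"
    by (rule eventually_compose_filterlim)
  with fk have "\<forall>\<^sub>F x in nhds 0. k x = g x" by eventually_elim simp
  then show "y = germ g" by (simp add: k(1) germ_eq_iff)
qed

lemma subgroup_right_quotient: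
  assumes G: "subgroup G diffeo_germs" and h: "germ h \<in> G" and f: "germ f \<in> G" "local_diffeo f"
  obtains g where "local_diffeo g" "germ (h \<circ> g) \<in> G"
    "\<forall>\<^sub>F x in nhds 0. g (f x) = x" "\<forall>\<^sub>F x in nhds 0. f (g x) = x"
proof -
  obtain g where g: "local_diffeo g" "\<forall>\<^sub>F x in nhds 0. g (f x) = x" "\<forall>\<^sub>F x in nhds 0. f (g x) = x"
    using local_diffeo_inverse[OF f(2)] by blast
  have "germ g \<in> G"
    using subgroup.m_inv_closed[OF G f(1)] diffeo_germs_inv[OF f(2) g] by simp
  then have "germ h \<otimes>\<^bsub>diffeo_germs\<^esub> germ g \<in> G"
    by (rule subgroup.m_closed[OF G h])
  then have "germ (h \<circ> g) \<in> G"
    using diffeo_germs_mult[OF local_diffeo_isCont[OF g(1)]] g(1) by (simp add: local_diffeo_def)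
  with g show ?thesis using that by blast
qed

section \<open>Jets of groups of germs containing all shifts\<close>

theorem theorem5p1:
  fixes F P :: "real^'n \<Rightarrow> real^'n"
    and W :: "(real^'n) set"
    and p :: nat
    and L :: "real^'n^'n"
    and G :: "(real^'n \<Rightarrow> real^'n) set set"
  assumes "open W" and "0 \<in> W" and "smooth_on W F" and "F 0 = 0"
    and "p \<ge> 1" and "jet (p - 1) F = (\<lambda>x. 0)"
    and "P = jet p F" and "homogeneous_map p P" and "P \<noteq> (\<lambda>x. 0)"
    and "p = 1 \<Longrightarrow> L \<noteq> 0 \<and> (\<forall>x. P x = L *v x)"
    and "subgroup G diffeo_germs"
    and A1: "Sh W F \<subseteq> G"
    and A2: "\<And>h. germ h \<in> G \<Longrightarrow>
      \<exists>\<omega>\<^sub>0::real. \<forall>x.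
        jet p h x = jet p (shift W F (\<lambda>_. \<omega>\<^sub>0)) x \<and>
        jet p (shift W F (\<lambda>_. \<omega>\<^sub>0)) x =
          (if p = 1 then mat_exp (\<omega>\<^sub>0 *\<^sub>R L) *v x else x + \<omega>\<^sub>0 *\<^sub>R P x)"
    and A3: "\<And>h k. germ h \<in> G \<Longrightarrow> k \<ge> p \<Longrightarrow> k \<ge> 2 \<Longrightarrow> jet (k - 1) h = jet (k - 1) id \<Longrightarrow>
      \<exists>!\<omega>. homogeneous_poly (k - p) \<omega> \<and>
        (\<forall>x. jet k h x = jet k (shift W F \<omega>) x \<and>
             jet k (shift W F \<omega>) x = x + \<omega> x *\<^sub>R P x)"
  shows "jets_inf (Sh W F) = jets_inf G \<and> Sh W F \<subseteq> G \<and> G \<subseteq> JSh W F"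
proof -
  have F: "open W" "0 \<in> W" "smooth_on W F" "F 0 = 0" by fact+
  have G: "subgroup G diffeo_germs" by fact
  obtain r M \<Gamma> where "flow_near_zero W F r M \<Gamma>"
    using flow_near_zero_exists[OF F] by blast
  then interpret flow_near_zero W F r M \<Gamma> .
  have "smooth_near0 F" using F unfolding smooth_near0_def by blast
  from jet_remainder[OF this, of "p - 1"] have F_flat: "vanishes_to p F"
    using \<open>jet (p - 1) F = (\<lambda>x. 0)\<close> \<open>p \<ge> 1\<close> by simp

  have G_rep: "\<exists>f. local_diffeo f \<and> g = germ f" if "g \<in> G" for g
    using subgroup.mem_carrier[OF G that] by (auto simp: diffeo_germs_def)
  have G_smooth: "smooth_near0 h" if h: "germ h \<in> G" for h
  proof -
    obtain f where f: "local_diffeo f" "germ h = germ f" using G_rep[OF h] by blast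
    show ?thesis by (rule smooth_near0_germ[OF local_diffeo_smooth_near0[OF f(1)] f(2)[symmetric]])
  qed
  have Sh_G: "germ (shift W F \<alpha>) \<in> G" if "smooth_near0 \<alpha>" for \<alpha>
    using A1 that unfolding Sh_def by blast

  define approximates where "approximates h j \<alpha> \<longleftrightarrow>
    smooth_on UNIV \<alpha> \<and> vanishes_to (Suc (p + j)) (\<lambda>x. h x - shift W F \<alpha> x)" for h j \<alpha>
  \<comment> \<open>conditions of \<open>borel_sum\<close> on the \<open>j\<close>-th correction, with \<open>\<epsilon> = 2\<^sup>-\<^sup>j\<close> in \<open>borel_term\<close>\<close>
  define correction where "correction j \<phi> \<longleftrightarrow> smooth_on UNIV \<phi> \<and>
    (\<forall>w x. set w \<subseteq> Basis \<longrightarrow> length w \<le> j \<longrightarrow> \<bar>fold dderiv w \<phi> x\<bar> \<le> (1 / 2) ^ j) \<and>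
    (\<forall>x. \<bar>\<phi> x\<bar> \<le> (1 / 2) ^ j * norm x ^ j)" for j and \<phi> :: "real^'n \<Rightarrow> real"

  have start: "\<exists>\<alpha>. approximates h 0 \<alpha>" if h: "germ h \<in> G" for h
  proof -
    obtain \<omega>\<^sub>0 where \<omega>\<^sub>0: "jet p h = jet p (shift W F (\<lambda>_. \<omega>\<^sub>0))"
      using A2[OF h] by blast
    have c: "smooth_on UNIV (\<lambda>_::real^'n. \<omega>\<^sub>0)"
      by (intro smooth_on_real_polynomial_function real_polynomial_function.intros(2))
    have "smooth_near0 (shift W F (\<lambda>_. \<omega>\<^sub>0))"
      by (rule G_smooth[OF Sh_G[OF smooth_on_UNIV_near0[OF c]]])
    from jet_eq_imp_vanishes_to[OF G_smooth[OF h] this \<omega>\<^sub>0] c show ?thesis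
      unfolding approximates_def by auto
  qed

  have step: "\<exists>\<beta>. approximates h (Suc j) \<beta> \<and> (\<exists>\<phi>. correction j \<phi> \<and> \<beta> = (\<lambda>x. \<alpha> x + \<phi> x))"
    if h: "germ h \<in> G" and app: "approximates h j \<alpha>" for h j \<alpha>
  proof -
    have \<alpha>: "smooth_near0 \<alpha>" and close: "vanishes_to (Suc (p + j)) (\<lambda>x. h x - shift W F \<alpha> x)"
      using app smooth_on_UNIV_near0 unfolding approximates_def by blast+
    obtain f where f: "local_diffeo f" "germ (shift W F \<alpha>) = germ f"
      using G_rep[OF Sh_G[OF \<alpha>]] by blast
    have fG: "germ f \<in> G" using Sh_G[OF \<alpha>] f(2) by simp
    have f_eq: "\<forall>\<^sub>F x in nhds 0. f x = shift W F \<alpha> x"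
      using f(2)[symmetric] by (simp only: germ_eq_iff)
    have f0: "f 0 = 0" using f(1) by (simp add: local_diffeo_def)
    obtain g where g: "local_diffeo g" "germ (h \<circ> g) \<in> G"
      "\<forall>\<^sub>F x in nhds 0. g (f x) = x" "\<forall>\<^sub>F x in nhds 0. f (g x) = x"
      using subgroup_right_quotient[OF G h fG f(1)] by blast
    define h' where "h' = h \<circ> g"
    have h'G: "germ h' \<in> G" using g(2) by (simp add: h'_def)
    have h_eq: "\<forall>\<^sub>F x in nhds 0. h x = h' (f x)"
      using g(3) by eventually_elim (simp add: h'_def)
    have g1: "vanishes_to 1 g"
      using g(1) by (intro smooth_near0_vanishes_to_1 local_diffeo_smooth_near0) (simp_all add: local_diffeo_def)
    have "\<forall>\<^sub>F x in nhds 0. h x - shift W F \<alpha> x = h x - f x"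
      using f_eq by eventually_elim simp
    from vanishes_to_transfer[OF this close] have "vanishes_to (Suc (p + j)) (\<lambda>x. h x - f x)" .
    from vanishes_to_compose[OF this g1]
    have "vanishes_to (Suc (p + j)) (\<lambda>x. h (g x) - f (g x))" .
    moreover have "\<forall>\<^sub>F x in nhds 0. h (g x) - f (g x) = h' x - id x"
      using g(4) by eventually_elim (simp add: h'_def)
    ultimately have "vanishes_to (Suc (p + j)) (\<lambda>x. h' x - id x)"
      by (rule vanishes_to_transfer[rotated])
    \<comment> \<open>the identity germ is the unit of the group and belongs to \<open>G\<close>\<close>
    moreover have "smooth_near0 (id :: real^'n \<Rightarrow> real^'n)"
      using G_smooth[of id] subgroup.one_closed[OF G] by (simp add: diffeo_germs_def)
    ultimately have jet_h': "jet (Suc (p + j) - 1) h' = jet (Suc (p + j) - 1) id"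
      using vanishes_to_imp_jet_eq[OF G_smooth[OF h'G]] by simp
    \<comment> \<open>(A3) is used in degree \<open>k = p + j + 1\<close>, so that \<open>k - p = j + 1\<close> is positive\<close>
    have p: "p \<le> Suc (p + j)" "2 \<le> Suc (p + j)" and degree: "Suc (p + j) - p = Suc j"
      using \<open>p \<ge> 1\<close> by auto
    obtain \<omega> where "homogeneous_poly (Suc (p + j) - p) \<omega>"
      and "\<forall>x. jet (Suc (p + j)) h' x = jet (Suc (p + j)) (shift W F \<omega>) x"
      using A3[OF h'G p jet_h'] by blast
    then have \<omega>: "homogeneous_poly (Suc j) \<omega>"
      and jet_\<omega>: "jet (Suc (p + j)) h' = jet (Suc (p + j)) (shift W F \<omega>)"
      unfolding degree by auto
    have poly: "real_polynomial_function \<omega>"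
      by (rule homogeneous_poly_real_polynomial_function[OF \<omega>])
    have "smooth_near0 (shift W F \<omega>)"
      by (rule G_smooth[OF Sh_G[OF smooth_on_UNIV_near0[OF smooth_on_real_polynomial_function[OF poly]]]])
    from jet_eq_imp_vanishes_to[OF G_smooth[OF h'G] this jet_\<omega>]
    have "vanishes_to (p + Suc (Suc j)) (\<lambda>x. h' x - shift W F \<omega> x)" by simp
    from approximation_step[OF F_flat \<alpha> local_diffeo_smooth_near0[OF f(1)] f0 f_eq h_eq poly
        homogeneous_poly_scaleR[OF \<omega>] this, of "(1 / 2) ^ j"]
    obtain \<phi> where \<phi>: "correction j \<phi>"
      "vanishes_to (p + Suc (Suc j)) (\<lambda>x. h x - shift W F (\<lambda>x. \<alpha> x + \<phi> x) x)"
      unfolding correction_def by auto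
    have "smooth_on UNIV (\<lambda>x. \<alpha> x + \<phi> x)"
      using app \<phi>(1) Ck_on_add unfolding approximates_def correction_def smooth_on_def by blast
    with \<phi> show ?thesis unfolding approximates_def by auto
  qed

  have jets: "\<exists>\<alpha>. smooth_near0 \<alpha> \<and> jet_inf h = jet_inf (shift W F \<alpha>)" if h: "germ h \<in> G" for h
  proof -
    obtain \<alpha> where \<alpha>: "\<And>j. approximates h j (\<alpha> j)"
      and ex: "\<And>j. \<exists>\<phi>. correction j \<phi> \<and> \<alpha> (Suc j) = (\<lambda>x. \<alpha> j x + \<phi> x)"
      using dependent_nat_choice[of "approximates h" "\<lambda>j \<alpha> \<beta>. \<exists>\<phi>. correction j \<phi> \<and> \<beta> = (\<lambda>x. \<alpha> x + \<phi> x)",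
          OF start[OF h] step[OF h]] by blast
    have "\<forall>j. \<exists>\<phi>. correction j \<phi> \<and> \<alpha> (Suc j) = (\<lambda>x. \<alpha> j x + \<phi> x)"
      using ex by blast
    from choice[OF this] obtain \<phi> where \<phi>: "\<And>j. correction j (\<phi> j)"
      and \<alpha>_Suc: "\<And>j. \<alpha> (Suc j) = (\<lambda>x. \<alpha> j x + \<phi> j x)" by blast
    have \<alpha>_sum: "\<alpha> k = (\<lambda>x. \<alpha> 0 x + (\<Sum>j<k. \<phi> j x))" for k
      by (induction k) (auto simp: \<alpha>_Suc)
    have "\<exists>\<beta>. smooth_on UNIV \<beta> \<and> (\<forall>k. vanishes_to k (\<lambda>x. \<beta> x - (\<alpha> 0 x + (\<Sum>j<k. \<phi> j x))))"
    proof (rule borel_sum)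
      show "smooth_on UNIV (\<alpha> 0)" using \<alpha>[of 0] unfolding approximates_def by blast
    qed (use \<phi> in \<open>unfold correction_def, blast\<close>)+
    then obtain \<beta> where \<beta>: "smooth_on UNIV \<beta>" and "\<And>k. vanishes_to k (\<lambda>x. \<beta> x - (\<alpha> 0 x + (\<Sum>j<k. \<phi> j x)))"
      by blast
    then have \<beta>_close: "vanishes_to k (\<lambda>x. \<beta> x - \<alpha> k x)" for k
      by (subst \<alpha>_sum)
    have bounded: "vanishes_to 0 \<gamma>" if "smooth_on UNIV \<gamma>" for \<gamma> :: "real^'n \<Rightarrow> real"
      by (intro vanishes_to_0_isCont smooth_near0_isCont smooth_on_UNIV_near0 that)
    have close: "vanishes_to (Suc i) (\<lambda>x. h x - shift W F \<beta> x)" for i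
    proof -
      have "smooth_on UNIV (\<alpha> (Suc i))" and 1: "vanishes_to (Suc (p + Suc i)) (\<lambda>x. h x - shift W F (\<alpha> (Suc i)) x)"
        using \<alpha>[of "Suc i"] unfolding approximates_def by blast+
      then have "vanishes_to (p + Suc i) (\<lambda>x. shift W F \<beta> x - shift W F (\<alpha> (Suc i)) x)"
        by (intro shift_diff_vanishes_to bounded \<beta> F_flat \<beta>_close)
      then have "vanishes_to (Suc i) (\<lambda>x. shift W F (\<alpha> (Suc i)) x - shift W F \<beta> x)"
        by (rule vanishes_to_sym[OF vanishes_to_mono]) simp
      moreover have "vanishes_to (Suc i) (\<lambda>x. h x - shift W F (\<alpha> (Suc i)) x)"
        using 1 by (rule vanishes_to_mono) simp
      ultimately show ?thesis by (rule vanishes_to_trans[rotated])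
    qed
    have \<beta>0: "smooth_near0 \<beta>" by (rule smooth_on_UNIV_near0[OF \<beta>])
    have "taylor_term i h = taylor_term i (shift W F \<beta>)" for i
      by (rule vanishes_to_imp_taylor_term_eq[OF G_smooth[OF h] G_smooth[OF Sh_G[OF \<beta>0]] close order_refl])
    with \<beta>0 show ?thesis unfolding jet_inf_def by blast
  qed

  have G_jets: "jet_inf h \<in> jets_inf (Sh W F)" if h: "germ h \<in> G" for h
    using jets[OF h] unfolding jets_inf_def Sh_def by blast
  have "jets_inf (Sh W F) = jets_inf G"
  proof
    show "jets_inf (Sh W F) \<subseteq> jets_inf G" using A1 unfolding jets_inf_def by blast
    show "jets_inf G \<subseteq> jets_inf (Sh W F)"
    proof
      fix J assume "J \<in> jets_inf G"
      then obtain h where "J = jet_inf h" "germ h \<in> G" unfolding jets_inf_def by blast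
      then show "J \<in> jets_inf (Sh W F)" using G_jets by simp
    qed
  qed
  moreover have "G \<subseteq> JSh W F"
  proof
    fix g assume "g \<in> G"
    then obtain h where "local_diffeo h" "g = germ h" "germ h \<in> G" using G_rep by blast
    then show "g \<in> JSh W F" using G_jets unfolding JSh_def by blast
  qed
  ultimately show ?thesis using A1 by blast
qed

end
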